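(* Assume that $Q^{\mathrm{dyn}}$ has finite time range and that the global foliation $(\eta_t)_{t\in\mathbb R}$ satisfies the hyperbolicity condition. Let $I=[t_0,t_{\max}]$ be a compact interval, $L=L_{t_0}^{t_{\max}}$ and $w\in L^2(L,SM)$. Let $\psi,\psi'\in C^{\mathrm{vary}}_{\mathrm{loc,t}}(M,SM)$ be two solutions of the dynamical wave equation in $L$, i.e. $Q^{\mathrm{dyn}}\psi=w=Q^{\mathrm{dyn}}\psi'$ in $L$, with zero initial data, $\|\psi\|^{t_0}_\rho=0=\|\psi'\|^{t_0}_\rho$. Then the solutions coincide in $L^2(L,SM)$.
   Context: Let $(\mathcal H,\langle\cdot|\cdot\rangle_{\mathcal H})$ be a separable complex Hilbert space (scalar product antilinear in the first argument), $n\in\mathbb N$, $\mathcal F\subset\mathrm L(\mathcal H)$ a smooth finite-dimensional manifold of selfadjoint finite-rank operators having exactly $n$ positive and $n$ negative eigenvalues (counting multiplicities) and a fixed trace, $\rho$ a locally finite regular Borel measure on $\mathcal F$ and $M:=\operatorname{supp}\rho$ (spacetime). Past sets. With fixed $\kappa>0$ let $\mathcal L_\kappa(x,y)=\frac1{4n}\sum_{i,j=1}^{2n}(|\lambda_i|-|\lambda_j|)^2+\kappa(\sum_j|\lambda_j|)^2$, where $\lambda_1,\dots,\lambda_{2n}$ are the eigenvalues of $xy$ (non-zero ones with algebraic multiplicity, filled up with zeros). Fix a finite-dimensional subspace $\mathcal H^{\mathrm f}\subset\mathcal H$; for every selfadjoint $A$ with $A(\mathcal H^{\mathrm f})\subset\mathcal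 H^{\mathrm f}$ and $A|_{(\mathcal H^{\mathrm f})^\perp}=0$ consider the vector field $\mathscr C_A(x)=i[A,x]$ and set $g_A(x,y)=|(D_{1,\mathscr C_A}-D_{2,\mathscr C_A})\mathcal L_\kappa(x,y)|$, where $D_1,D_2$ are directional derivatives acting on the first resp. second argument. A Borel set $\Omega\subset M$ is surface layer finite if all $g_A$ are integrable over $\Omega\times(M\setminus\Omega)$; two such sets are causally equivalent if all $g_A$ are integrable over $K\times K$, with $K$ their symmetric difference. It is assumed that there are precisely four equivalence classes $[\varnothing],[M],[\Omega_0],[M\setminus\Omega_0]$ and that $[\Omega_0]$ is distinguished; its elements are the past sets. Wave functions. $S_x:=x(\mathcal H)$ carries the spin inner product $\prec u|v\succ_x=-\langle u|xv\rangle_{\mathcal H}$ and the scalar product $\langle\!\langle u|v\rangle\!\rangle_x=\langle u|\,|x|\,v\rangle_{\mathcal H}$. A wave function is a map $\psi$ on $M$ with $\psi(x)\in S_x$; it is continuous if $x\mapsto\sqrt{|x|}\psi(x)\in\mathcal H$ is continuous; $C^0(M,SM)$ is the space of continuous wave functions. $C^{\mathrm{vary}}(M,SM)\subset C^0(M,SM)$ is a chosen linear subspace. Operator. $Q^{\mathrm{dyn}}(x,y):S_y\to S_x$ is a given kernel, symmetric in the sense $Q^{\mathrm{dyn}}(x,y)^*=Q^{\mathrm{dyn}}(y,x)$ (adjoints with respect to the spin inner products; a multiple of $\delta(x,y)$ on the diagonal is allowed), and $(Q^{\mathrm{dyn}}\psi)(x)=\int_MQ^{\mathrm{dyn}}(x,y)\psi(y)\,d\rho(y)$.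 Global foliation. $\eta\in C^\infty(\mathbb R\times M,\mathbb R)$, $0\le\eta\le1$, $\eta_t:=\eta(t,\cdot)$, $\theta_t:=\partial_t\eta(t,\cdot)$, such that for all $t$: (i) $\operatorname{supp}\eta_t$ is a past set; (ii) $\theta_t\ge0$; (iii) there are $t_0,t_1\in\mathbb R$ such that $\theta_t(x)\ne0$ implies $\eta_{t_0}(x)=0$ and $\eta_{t_1}(x)=1$; and (iv) $M=\bigcup_t\operatorname{supp}\theta_t$. Set $d\rho_t=\theta_t\,d\rho$. For $t_0<t_1$ the time strip is $L_{t_0}^{t_1}=\bigcup_{t\in[t_0,t_1]}\operatorname{supp}\theta_t$; with $\eta_I=\eta_{t_1}-\eta_{t_0}$ set $\langle\psi|\phi\rangle_{L^2(L)}=\int_M\langle\!\langle\psi|\phi\rangle\!\rangle_x\,\eta_I(x)\,d\rho(x)$, with Hilbert space $L^2(L,SM)$. $L^2_{\mathrm{loc,t}}(M,SM)$ denotes the wave functions which are in $L^2(L,SM)$ for every time strip $L$, and $C^{\mathrm{vary}}_{\mathrm{loc,t}}:=C^{\mathrm{vary}}\cap L^2_{\mathrm{loc,t}}$. Finite time range: there is $r>0$ with $Q^{\mathrm{dyn}}(x,y)=0$ whenever $x\in\operatorname{supp}\theta_{t_0}$, $y\in\operatorname{supp}\theta_{t_1}$ and $|t_1-t_0|>r$; and $Q^{\mathrm{dyn}}(L^2_{\mathrm{loc,t}}(M,SM))\subset L^2_{\mathrm{loc,t}}(M,SM)$. Softened surface layer form: $$\langle\psi|\phi\rangle^t_\rho=-2i\int_Md\rho(x)\int_Md\rho(y)\,\big(\eta_t(x)(1-\eta_t(y))-(1-\eta_t(x))\eta_t(y)\big)\prec\psi(x)|Q^{\mathrm{dyn}}(x,y)\phi(y)\succ_x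 .$$ By finite time range, only $x,y$ in a bounded time strip contribute, and the form is used for $\psi,\phi\in L^2_{\mathrm{loc,t}}(M,SM)$ (existence of the double integrals, interchange of the order of integration and differentiation in $t$ under the integrals being understood). $\|\psi\|^t_\rho:=\sqrt{\langle\psi|\psi\rangle^t_\rho}$. Hyperbolicity condition: for any compact interval $I=[t_0,t_{\max}]$ there is $C=C(I)>0$ such that for all $t\in I$ and all $\psi\in C^{\mathrm{vary}}_{\mathrm{loc,t}}(M,SM)$, $\langle\psi|\psi\rangle^t_\rho\ge\frac1{C^2}\int_M\langle\!\langle\psi(x)|\psi(x)\rangle\!\rangle_x\,d\rho_t(x)$. *)

theory Defs
  imports "HOL-Analysis.Analysis"
begin

section \<open>Complex Hilbert spaces and operators\<close>

text \<open>
  A separable complex Hilbert space: complete, with a norm induced by a scalar product that is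
  antilinear in the first argument.  For metric spaces, separability is
  \<^class>\<open>second_countable_topology\<close>; positive definiteness of the scalar product follows from
  \<open>norm_eq_sqrt_cinner\<close>.
\<close>

class separable_complex_hilbert = banach + second_countable_topology +
  fixes scaleC :: "complex \<Rightarrow> 'a \<Rightarrow> 'a" (infixr "*\<^sub>C" 75)
    and cinner :: "'a \<Rightarrow> 'a \<Rightarrow> complex"
  assumes scaleC_add_right: "c *\<^sub>C (u + v) = c *\<^sub>C u + c *\<^sub>C v"
    and scaleC_add_left: "(c + d) *\<^sub>C u = c *\<^sub>C u + d *\<^sub>C u"
    and scaleC_scaleC: "c *\<^sub>C d *\<^sub>C u = (c * d) *\<^sub>C u"
    and scaleC_of_real: "of_real r *\<^sub>C u = r *\<^sub>R u"
    and cinner_add_right: "cinner u (v + w) = cinner u v + cinner u w"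
    and cinner_scaleC_right: "cinner u (c *\<^sub>C v) = c * cinner u v"
    and cinner_commute: "cinner u v = cnj (cinner v u)"
    and norm_eq_sqrt_cinner: "norm u = sqrt (Re (cinner u u))"

global_interpretation complex_vector:
  vector_space "scaleC :: complex \<Rightarrow> 'h \<Rightarrow> 'h::separable_complex_hilbert"
proof
  fix u :: 'h
  show "1 *\<^sub>C u = u" using scaleC_of_real[of 1 u] by simp
qed (simp_all add: scaleC_add_right scaleC_add_left scaleC_scaleC)

definition complex_finite_dim :: "'h::separable_complex_hilbert set \<Rightarrow> bool" where
  "complex_finite_dim S \<longleftrightarrow> (\<exists>B. finite B \<and> S \<subseteq> complex_vector.span B)"

text \<open>
  The type \<open>'h \<Rightarrow>\<^sub>L 'h\<close> contains all bounded real-linear maps and carries the operator norm.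
  The symmetry condition below forces complex linearity, so the selfadjoint elements of this type
  are exactly the selfadjoint elements of \<open>L(H)\<close>.
\<close>

type_synonym 'h opr = "'h \<Rightarrow>\<^sub>L 'h"

definition selfadjoint :: "'h::separable_complex_hilbert opr \<Rightarrow> bool" where
  "selfadjoint T \<longleftrightarrow> (\<forall>u v. cinner (T u) v = cinner u (T v))"

definition positive_op :: "'h::separable_complex_hilbert opr \<Rightarrow> bool" where
  "positive_op T \<longleftrightarrow> selfadjoint T \<and> (\<forall>u. 0 \<le> Re (cinner u (T u)))"

definition op_sqrt :: "'h::separable_complex_hilbert opr \<Rightarrow> 'h opr" where
  "op_sqrt T = (THE S. positive_op S \<and> S o\<^sub>L S = T)"

text \<open>Absolute value \<open>|x| = sqrt (x\<^sup>* x)\<close> of a selfadjoint operator.\<close>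

definition op_abs :: "'h::separable_complex_hilbert opr \<Rightarrow> 'h opr" where
  "op_abs x = op_sqrt (x o\<^sub>L x)"

definition spin_space :: "'h::separable_complex_hilbert opr \<Rightarrow> 'h set" where
  "spin_space x = range (blinfun_apply x)"

definition eigenspace :: "'h::separable_complex_hilbert opr \<Rightarrow> complex \<Rightarrow> 'h set" where
  "eigenspace T z = {u. T u = z *\<^sub>C u}"

text \<open>
  The sums below run over finite sets for selfadjoint operators of finite rank, the only case in
  which they are used.
\<close>

definition num_pos_eigenvalues :: "'h::separable_complex_hilbert opr \<Rightarrow> nat" where
  "num_pos_eigenvalues T =
    (\<Sum>l | l > (0::real) \<and> eigenspace T (of_real l) \<noteq> {0}. complex_vector.dim (eigenspace T (of_real l)))"

definition num_neg_eigenvalues :: "'h::separable_complex_hilbert opr \<Rightarrow> nat" where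
  "num_neg_eigenvalues T =
    (\<Sum>l | l < (0::real) \<and> eigenspace T (of_real l) \<noteq> {0}. complex_vector.dim (eigenspace T (of_real l)))"

definition op_trace :: "'h::separable_complex_hilbert opr \<Rightarrow> real" where
  "op_trace T =
    (\<Sum>l | l \<noteq> (0::real) \<and> eigenspace T (of_real l) \<noteq> {0}.
       l * real (complex_vector.dim (eigenspace T (of_real l))))"

definition algebraic_multiplicity :: "'h::separable_complex_hilbert opr \<Rightarrow> complex \<Rightarrow> nat" where
  "algebraic_multiplicity T z =
    complex_vector.dim (\<Union>k. {u. ((\<lambda>v. T v - z *\<^sub>C v) ^^ k) u = 0})"

text \<open>
  The \<open>m\<close> eigenvalues of an operator of rank at most \<open>m\<close>, non-zero ones with algebraic
  multiplicity, filled up with zeros.  The list is unique up to ordering.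
\<close>

definition eigenvalue_list :: "nat \<Rightarrow> 'h::separable_complex_hilbert opr \<Rightarrow> complex list" where
  "eigenvalue_list m T =
    (SOME ls. length ls = m \<and> (\<forall>z. z \<noteq> 0 \<longrightarrow> count_list ls z = algebraic_multiplicity T z))"


section \<open>Smooth functions and submanifolds\<close>

text \<open>
  If all iterated directional derivatives are Frechet differentiable, then on an open subset of a
  Banach space the uniform boundedness principle makes all Frechet derivatives norm-continuous;
  thus \<open>\<forall>k. Ck_on k U f\<close> is smoothness in the usual sense.
\<close>

primrec Ck_on :: "nat \<Rightarrow> 'a::real_normed_vector set \<Rightarrow> ('a \<Rightarrow> 'b::real_normed_vector) \<Rightarrow> bool" where
  "Ck_on 0 U f \<longleftrightarrow> continuous_on U f"
| "Ck_on (Suc k) U f \<longleftrightarrow> (\<forall>x\<in>U. f differentiable (at x)) \<and>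
     (\<forall>v. Ck_on k U (\<lambda>x. frechet_derivative f (at x) v))"

text \<open>On an arbitrary subset, smooth means: locally the restriction of a smooth function.\<close>

definition smooth_on :: "'a::real_normed_vector set \<Rightarrow> ('a \<Rightarrow> 'b::real_normed_vector) \<Rightarrow> bool" where
  "smooth_on S f \<longleftrightarrow> (\<forall>p\<in>S. \<exists>U h. open U \<and> p \<in> U \<and> (\<forall>k. Ck_on k U h) \<and> (\<forall>x\<in>U \<inter> S. h x = f x))"

text \<open>
  \<open>F\<close> is locally diffeomorphic to an open subset of a \<open>d\<close>-dimensional vector space.  The model
  space is taken inside the ambient space, which is no restriction since the tangent space of
  \<open>F\<close> lies there.
\<close>

definition smooth_submanifold :: "'a::real_normed_vector set \<Rightarrow> bool" where
  "smooth_submanifold F \<longleftrightarrow> (\<exists>d::nat. \<forall>p\<in>F. \<exists>W (B :: 'a set) V \<phi> \<zeta>.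
     open W \<and> p \<in> W \<and> finite B \<and> independent B \<and> card B = d \<and>
     openin (top_of_set (span B)) V \<and> homeomorphism V (F \<inter> W) \<phi> \<zeta> \<and>
     smooth_on V \<phi> \<and> smooth_on (F \<inter> W) \<zeta>)"

definition tangent_curve ::
  "'a::real_normed_vector set \<Rightarrow> 'a \<Rightarrow> 'a \<Rightarrow> (real \<Rightarrow> 'a) \<Rightarrow> bool" where
  "tangent_curve F x v \<gamma> \<longleftrightarrow>
    smooth_on UNIV \<gamma> \<and> range \<gamma> \<subseteq> F \<and> \<gamma> 0 = x \<and> (\<gamma> has_vector_derivative v) (at 0)"

text \<open>
  Derivative of a function on \<open>F\<close> in the direction of a tangent vector \<open>v\<close>.  The first conjunct
  says that \<open>v\<close> is tangential to \<open>F\<close>.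
\<close>

definition has_directional_derivative ::
  "'a::real_normed_vector set \<Rightarrow> ('a \<Rightarrow> real) \<Rightarrow> 'a \<Rightarrow> 'a \<Rightarrow> real \<Rightarrow> bool" where
  "has_directional_derivative F f x v d \<longleftrightarrow>
    (\<exists>\<gamma>. tangent_curve F x v \<gamma>) \<and>
    (\<forall>\<gamma>. tangent_curve F x v \<gamma> \<longrightarrow> ((\<lambda>s. f (\<gamma> s)) has_real_derivative d) (at 0))"

definition directional_derivative ::
  "'a::real_normed_vector set \<Rightarrow> ('a \<Rightarrow> real) \<Rightarrow> 'a \<Rightarrow> 'a \<Rightarrow> real" where
  "directional_derivative F f x v = (THE d. has_directional_derivative F f x v d)"


section \<open>Spacetime\<close>

definition regular_borel_measure_on :: "'a::topological_space set \<Rightarrow> 'a measure \<Rightarrow> bool" where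
  "regular_borel_measure_on F \<rho> \<longleftrightarrow>
    sets \<rho> = sets (restrict_space borel F) \<and>
    (\<forall>A\<in>sets \<rho>. emeasure \<rho> A = (SUP K\<in>{K. compact K \<and> K \<subseteq> A \<and> K \<in> sets \<rho>}. emeasure \<rho> K) \<and>
                emeasure \<rho> A = (INF U\<in>{U. openin (top_of_set F) U \<and> A \<subseteq> U}. emeasure \<rho> U))"

definition locally_finite_on :: "'a::topological_space set \<Rightarrow> 'a measure \<Rightarrow> bool" where
  "locally_finite_on F \<rho> \<longleftrightarrow> (\<forall>x\<in>F. \<exists>U. openin (top_of_set F) U \<and> x \<in> U \<and> emeasure \<rho> U < \<infinity>)"

definition causal_fermion_system ::
  "nat \<Rightarrow> 'h::separable_complex_hilbert opr set \<Rightarrow> 'h opr measure \<Rightarrow> bool" where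
  "causal_fermion_system n F \<rho> \<longleftrightarrow>
    0 < n \<and>
    smooth_submanifold F \<and>
    (\<forall>x\<in>F. selfadjoint x \<and> complex_finite_dim (spin_space x) \<and>
       num_pos_eigenvalues x = n \<and> num_neg_eigenvalues x = n) \<and>
    (\<exists>c. \<forall>x\<in>F. op_trace x = c) \<and>
    regular_borel_measure_on F \<rho> \<and> locally_finite_on F \<rho>"

text \<open>Spacetime, i.e. the support of \<open>\<rho>\<close>; note that \<open>space \<rho> = F\<close>.\<close>

definition spacetime :: "'a::topological_space measure \<Rightarrow> 'a set" where
  "spacetime \<rho> =
    {x \<in> space \<rho>. \<forall>U. openin (top_of_set (space \<rho>)) U \<and> x \<in> U \<longrightarrow> 0 < emeasure \<rho> U}"

abbreviation spacetime_measure :: "'a::topological_space measure \<Rightarrow> 'a measure" where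
  "spacetime_measure \<rho> \<equiv> restrict_space \<rho> (spacetime \<rho>)"


section \<open>Past sets\<close>

definition lagrangian ::
  "nat \<Rightarrow> real \<Rightarrow> 'h::separable_complex_hilbert opr \<Rightarrow> 'h opr \<Rightarrow> real" where
  "lagrangian n \<kappa> x y =
    (let ls = eigenvalue_list (2 * n) (x o\<^sub>L y) in
       1 / (4 * real n) * (\<Sum>i<2*n. \<Sum>j<2*n. (cmod (ls ! i) - cmod (ls ! j))\<^sup>2)
       + \<kappa> * (\<Sum>j<2*n. cmod (ls ! j))\<^sup>2)"

definition commutator_field ::
  "'h::separable_complex_hilbert opr \<Rightarrow> 'h opr \<Rightarrow> 'h opr" where
  "commutator_field A x = Blinfun (\<lambda>u. \<i> *\<^sub>C (A (x u) - x (A u)))"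

definition symmetry_generators ::
  "'h::separable_complex_hilbert set \<Rightarrow> 'h opr set" where
  "symmetry_generators Hf =
    {A. selfadjoint A \<and> A ` Hf \<subseteq> Hf \<and> (\<forall>u. (\<forall>v\<in>Hf. cinner v u = 0) \<longrightarrow> A u = 0)}"

definition layer_derivatives_exist ::
  "nat \<Rightarrow> real \<Rightarrow> 'h::separable_complex_hilbert opr set \<Rightarrow> 'h opr \<Rightarrow> 'h opr \<Rightarrow> 'h opr \<Rightarrow> bool" where
  "layer_derivatives_exist n \<kappa> F A x y \<longleftrightarrow>
    (\<exists>d. has_directional_derivative F (\<lambda>z. lagrangian n \<kappa> z y) x (commutator_field A x) d) \<and>
    (\<exists>d. has_directional_derivative F (\<lambda>z. lagrangian n \<kappa> x z) y (commutator_field A y) d)"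

definition layer_density ::
  "nat \<Rightarrow> real \<Rightarrow> 'h::separable_complex_hilbert opr set \<Rightarrow> 'h opr \<Rightarrow> 'h opr \<Rightarrow> 'h opr \<Rightarrow> real" where
  "layer_density n \<kappa> F A x y =
    \<bar>directional_derivative F (\<lambda>z. lagrangian n \<kappa> z y) x (commutator_field A x)
     - directional_derivative F (\<lambda>z. lagrangian n \<kappa> x z) y (commutator_field A y)\<bar>"

text \<open>
  Integrability of all \<open>g\<^sub>A\<close> over a subset \<open>S\<close> of \<open>M \<times> M\<close>, which includes that the derivatives
  of the Lagrangian exist almost everywhere on \<open>S\<close>.
\<close>

definition layer_integrable ::
  "nat \<Rightarrow> real \<Rightarrow> 'h::separable_complex_hilbert set \<Rightarrow> 'h opr measure \<Rightarrow> ('h opr \<times> 'h opr) set \<Rightarrow> bool" where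
  "layer_integrable n \<kappa> Hf \<rho> S \<longleftrightarrow>
    (\<forall>A\<in>symmetry_generators Hf.
       (AE (x, y) in spacetime_measure \<rho> \<Otimes>\<^sub>M spacetime_measure \<rho>.
          (x, y) \<in> S \<longrightarrow> layer_derivatives_exist n \<kappa> (space \<rho>) A x y) \<and>
       set_integrable (spacetime_measure \<rho> \<Otimes>\<^sub>M spacetime_measure \<rho>) S
         (\<lambda>(x, y). layer_density n \<kappa> (space \<rho>) A x y))"

definition surface_layer_finite_sets ::
  "nat \<Rightarrow> real \<Rightarrow> 'h::separable_complex_hilbert set \<Rightarrow> 'h opr measure \<Rightarrow> 'h opr set set" where
  "surface_layer_finite_sets n \<kappa> Hf \<rho> =
    {\<Omega> \<in> sets (spacetime_measure \<rho>). layer_integrable n \<kappa> Hf \<rho> (\<Omega> \<times> (spacetime \<rho> - \<Omega>))}"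

definition causal_equivalence ::
  "nat \<Rightarrow> real \<Rightarrow> 'h::separable_complex_hilbert set \<Rightarrow> 'h opr measure \<Rightarrow> ('h opr set \<times> 'h opr set) set" where
  "causal_equivalence n \<kappa> Hf \<rho> =
    {(\<Omega>, \<Omega>'). \<Omega> \<in> surface_layer_finite_sets n \<kappa> Hf \<rho> \<and> \<Omega>' \<in> surface_layer_finite_sets n \<kappa> Hf \<rho> \<and>
       (let K = (\<Omega> - \<Omega>') \<union> (\<Omega>' - \<Omega>) in layer_integrable n \<kappa> Hf \<rho> (K \<times> K))}"

definition four_causal_classes ::
  "nat \<Rightarrow> real \<Rightarrow> 'h::separable_complex_hilbert set \<Rightarrow> 'h opr measure \<Rightarrow> 'h opr set \<Rightarrow> bool" where
  "four_causal_classes n \<kappa> Hf \<rho> \<Omega>0 \<longleftrightarrow>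
    0 < \<kappa> \<and> complex_vector.subspace Hf \<and> complex_finite_dim Hf \<and>
    (let S = surface_layer_finite_sets n \<kappa> Hf \<rho>; R = causal_equivalence n \<kappa> Hf \<rho>; M = spacetime \<rho> in
       equiv S R \<and> \<Omega>0 \<in> S \<and> S // R = {R `` {{}}, R `` {M}, R `` {\<Omega>0}, R `` {M - \<Omega>0}} \<and>
       card (S // R) = 4)"

definition past_sets ::
  "nat \<Rightarrow> real \<Rightarrow> 'h::separable_complex_hilbert set \<Rightarrow> 'h opr measure \<Rightarrow> 'h opr set \<Rightarrow> 'h opr set set" where
  "past_sets n \<kappa> Hf \<rho> \<Omega>0 = causal_equivalence n \<kappa> Hf \<rho> `` {\<Omega>0}"


section \<open>Wave functions\<close>

definition spin_inner :: "'h::separable_complex_hilbert opr \<Rightarrow> 'h \<Rightarrow> 'h \<Rightarrow> complex" where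
  "spin_inner x u v = - cinner u (x v)"

definition spin_scalar :: "'h::separable_complex_hilbert opr \<Rightarrow> 'h \<Rightarrow> 'h \<Rightarrow> complex" where
  "spin_scalar x u v = cinner u (op_abs x v)"

text \<open>
  Only the values of a wave function on \<open>M\<close> matter.
\<close>

type_synonym 'h wave = "'h opr \<Rightarrow> 'h"

definition wave_functions_on :: "'h::separable_complex_hilbert opr set \<Rightarrow> 'h wave set" where
  "wave_functions_on S = {\<psi>. \<forall>x\<in>S. \<psi> x \<in> spin_space x}"

definition continuous_wave_functions ::
  "'h::separable_complex_hilbert opr measure \<Rightarrow> 'h wave set" where
  "continuous_wave_functions \<rho> =
    {\<psi> \<in> wave_functions_on (spacetime \<rho>). continuous_on (spacetime \<rho>) (\<lambda>x. op_sqrt (op_abs x) (\<psi> x))}"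

definition wave_subspace :: "'h::separable_complex_hilbert wave set \<Rightarrow> bool" where
  "wave_subspace W \<longleftrightarrow> (\<lambda>x. 0) \<in> W \<and>
    (\<forall>\<psi>\<in>W. \<forall>\<phi>\<in>W. (\<lambda>x. \<psi> x + \<phi> x) \<in> W) \<and> (\<forall>c. \<forall>\<psi>\<in>W. (\<lambda>x. c *\<^sub>C \<psi> x) \<in> W)"


section \<open>Global foliations\<close>

definition theta :: "(real \<Rightarrow> 'a \<Rightarrow> real) \<Rightarrow> real \<Rightarrow> 'a \<Rightarrow> real" where
  "theta \<eta> t x = deriv (\<lambda>s. \<eta> s x) t"

definition support_in :: "'a::topological_space set \<Rightarrow> ('a \<Rightarrow> real) \<Rightarrow> 'a set" where
  "support_in M f = M \<inter> closure {x \<in> M. f x \<noteq> 0}"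

definition global_foliation ::
  "'a::real_normed_vector set set \<Rightarrow> 'a measure \<Rightarrow> (real \<Rightarrow> 'a \<Rightarrow> real) \<Rightarrow> bool" where
  "global_foliation P \<rho> \<eta> \<longleftrightarrow>
    (let M = spacetime \<rho> in
      smooth_on (UNIV \<times> M) (\<lambda>(t, x). \<eta> t x) \<and>
      (\<forall>t. \<forall>x\<in>M. 0 \<le> \<eta> t x \<and> \<eta> t x \<le> 1) \<and>
      (\<forall>t. support_in M (\<eta> t) \<in> P) \<and>
      (\<forall>t. \<forall>x\<in>M. 0 \<le> theta \<eta> t x) \<and>
      (\<forall>t. \<exists>t0 t1. \<forall>x\<in>M. theta \<eta> t x \<noteq> 0 \<longrightarrow> \<eta> t0 x = 0 \<and> \<eta> t1 x = 1) \<and>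
      M = (\<Union>t. support_in M (theta \<eta> t)))"

definition leaf_measure ::
  "'a::topological_space measure \<Rightarrow> (real \<Rightarrow> 'a \<Rightarrow> real) \<Rightarrow> real \<Rightarrow> 'a measure" where
  "leaf_measure \<rho> \<eta> t = density (spacetime_measure \<rho>) (\<lambda>x. ennreal (theta \<eta> t x))"

definition time_strip ::
  "'a::topological_space measure \<Rightarrow> (real \<Rightarrow> 'a \<Rightarrow> real) \<Rightarrow> real \<Rightarrow> real \<Rightarrow> 'a set" where
  "time_strip \<rho> \<eta> t0 t1 = (\<Union>t\<in>{t0..t1}. support_in (spacetime \<rho>) (theta \<eta> t))"

definition strip_measure ::
  "'a::topological_space measure \<Rightarrow> (real \<Rightarrow> 'a \<Rightarrow> real) \<Rightarrow> real \<Rightarrow> real \<Rightarrow> 'a measure" where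
  "strip_measure \<rho> \<eta> t0 t1 = density (spacetime_measure \<rho>) (\<lambda>x. ennreal (\<eta> t1 x - \<eta> t0 x))"

text \<open>
  Square integrable wave functions in the strip, not yet identified almost everywhere.
  Measurability is required of \<open>sqrt |x| \<psi>(x)\<close>, in line with the definition of continuity.  The
  weight \<open>\<eta>\<^sub>I\<close> vanishes outside the strip.
\<close>

definition L2_strip ::
  "'h::separable_complex_hilbert opr measure \<Rightarrow> (real \<Rightarrow> 'h opr \<Rightarrow> real) \<Rightarrow> real \<Rightarrow> real \<Rightarrow> 'h wave set" where
  "L2_strip \<rho> \<eta> t0 t1 =
    {\<psi> \<in> wave_functions_on (time_strip \<rho> \<eta> t0 t1).
       (\<lambda>x. op_sqrt (op_abs x) (\<psi> x))
         \<in> borel_measurable (restrict_space (spacetime_measure \<rho>) (time_strip \<rho> \<eta> t0 t1)) \<and>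
       integrable (spacetime_measure \<rho>) (\<lambda>x. Re (spin_scalar x (\<psi> x) (\<psi> x)) * (\<eta> t1 x - \<eta> t0 x))}"

text \<open>Equality of the induced elements of the Hilbert space \<open>L\<^sup>2(L,SM)\<close>.\<close>

definition L2_strip_eq ::
  "'h::separable_complex_hilbert opr measure \<Rightarrow> (real \<Rightarrow> 'h opr \<Rightarrow> real) \<Rightarrow> real \<Rightarrow> real \<Rightarrow> 'h wave \<Rightarrow> 'h wave \<Rightarrow> bool" where
  "L2_strip_eq \<rho> \<eta> t0 t1 \<psi> \<phi> \<longleftrightarrow> (AE x in strip_measure \<rho> \<eta> t0 t1. \<psi> x = \<phi> x)"

definition L2_loc_t ::
  "'h::separable_complex_hilbert opr measure \<Rightarrow> (real \<Rightarrow> 'h opr \<Rightarrow> real) \<Rightarrow> 'h wave set" where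
  "L2_loc_t \<rho> \<eta> =
    {\<psi> \<in> wave_functions_on (spacetime \<rho>). \<forall>t0 t1. t0 < t1 \<longrightarrow> \<psi> \<in> L2_strip \<rho> \<eta> t0 t1}"


section \<open>The dynamical wave operator\<close>

text \<open>
  The kernel is \<open>Q x y + c \<delta>(x,y)\<close>, where \<open>Q x y\<close> is a linear map from \<open>S\<^sub>y\<close> to \<open>S\<^sub>x\<close>; by symmetry,
  \<open>c\<close> is real.
\<close>

type_synonym 'h kernel = "'h opr \<Rightarrow> 'h opr \<Rightarrow> 'h \<Rightarrow> 'h"

definition symmetric_kernel ::
  "'h::separable_complex_hilbert opr measure \<Rightarrow> 'h kernel \<Rightarrow> bool" where
  "symmetric_kernel \<rho> Q \<longleftrightarrow>
    (\<forall>x\<in>spacetime \<rho>. \<forall>y\<in>spacetime \<rho>.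
       Q x y ` spin_space y \<subseteq> spin_space x \<and>
       (\<forall>u\<in>spin_space y. \<forall>v\<in>spin_space y. Q x y (u + v) = Q x y u + Q x y v) \<and>
       (\<forall>a. \<forall>u\<in>spin_space y. Q x y (a *\<^sub>C u) = a *\<^sub>C Q x y u) \<and>
       (\<forall>u\<in>spin_space x. \<forall>v\<in>spin_space y. spin_inner x u (Q x y v) = spin_inner y (Q y x u) v))"

definition Q_dyn ::
  "'h::separable_complex_hilbert opr measure \<Rightarrow> 'h kernel \<Rightarrow> real \<Rightarrow> 'h wave \<Rightarrow> 'h wave" where
  "Q_dyn \<rho> Q c \<psi> x = (LINT y|spacetime_measure \<rho>. Q x y (\<psi> y)) + c *\<^sub>R \<psi> x"

definition finite_time_range ::
  "'h::separable_complex_hilbert opr measure \<Rightarrow> (real \<Rightarrow> 'h opr \<Rightarrow> real) \<Rightarrow> 'h kernel \<Rightarrow> real \<Rightarrow> bool" where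
  "finite_time_range \<rho> \<eta> Q c \<longleftrightarrow>
    (\<exists>r>0. \<forall>t0 t1. \<bar>t1 - t0\<bar> > r \<longrightarrow>
       (\<forall>x\<in>support_in (spacetime \<rho>) (theta \<eta> t0). \<forall>y\<in>support_in (spacetime \<rho>) (theta \<eta> t1).
          \<forall>u\<in>spin_space y. Q x y u = 0)) \<and>
    (\<forall>\<psi>\<in>L2_loc_t \<rho> \<eta>.
       (AE x in spacetime_measure \<rho>. integrable (spacetime_measure \<rho>) (\<lambda>y. Q x y (\<psi> y))) \<and>
       Q_dyn \<rho> Q c \<psi> \<in> L2_loc_t \<rho> \<eta>)"

definition layer_weight :: "(real \<Rightarrow> 'a \<Rightarrow> real) \<Rightarrow> real \<Rightarrow> 'a \<Rightarrow> 'a \<Rightarrow> real" where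
  "layer_weight \<eta> t x y = \<eta> t x * (1 - \<eta> t y) - (1 - \<eta> t x) * \<eta> t y"

text \<open>
  The contribution \<open>c \<delta>(x,y)\<close> of the kernel drops out of the softened surface layer form because
  the weight vanishes on the diagonal.
\<close>

definition layer_form ::
  "'h::separable_complex_hilbert opr measure \<Rightarrow> (real \<Rightarrow> 'h opr \<Rightarrow> real) \<Rightarrow> 'h kernel \<Rightarrow> real
    \<Rightarrow> 'h wave \<Rightarrow> 'h wave \<Rightarrow> complex" where
  "layer_form \<rho> \<eta> Q t \<psi> \<phi> =
    - 2 * \<i> * (LINT x|spacetime_measure \<rho>. LINT y|spacetime_measure \<rho>.
       of_real (layer_weight \<eta> t x y) * spin_inner x (\<psi> x) (Q x y (\<phi> y)))"

definition layer_norm ::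
  "'h::separable_complex_hilbert opr measure \<Rightarrow> (real \<Rightarrow> 'h opr \<Rightarrow> real) \<Rightarrow> 'h kernel \<Rightarrow> real
    \<Rightarrow> 'h wave \<Rightarrow> real" where
  "layer_norm \<rho> \<eta> Q t \<psi> = sqrt (Re (layer_form \<rho> \<eta> Q t \<psi> \<psi>))"

definition double_integral_exists :: "'a measure \<Rightarrow> ('a \<Rightarrow> 'a \<Rightarrow> complex) \<Rightarrow> bool" where
  "double_integral_exists \<mu> f \<longleftrightarrow>
    (AE x in \<mu>. integrable \<mu> (\<lambda>y. f x y)) \<and> integrable \<mu> (\<lambda>x. LINT y|\<mu>. f x y) \<and>
    (AE y in \<mu>. integrable \<mu> (\<lambda>x. f x y)) \<and> integrable \<mu> (\<lambda>y. LINT x|\<mu>. f x y) \<and>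
    (LINT x|\<mu>. LINT y|\<mu>. f x y) = (LINT y|\<mu>. LINT x|\<mu>. f x y)"

text \<open>
  The conventions under which the surface layer form is used: the double integrals exist, the
  orders of integration may be interchanged (both for the form and for the separate terms of its
  time derivative) and the form may be differentiated in \<open>t\<close> under the integrals.
\<close>

definition layer_form_conventions ::
  "'h::separable_complex_hilbert opr measure \<Rightarrow> (real \<Rightarrow> 'h opr \<Rightarrow> real) \<Rightarrow> 'h kernel \<Rightarrow> bool" where
  "layer_form_conventions \<rho> \<eta> Q \<longleftrightarrow>
    (\<forall>\<psi>\<in>L2_loc_t \<rho> \<eta>. \<forall>\<phi>\<in>L2_loc_t \<rho> \<eta>. \<forall>t.
      (let \<mu> = spacetime_measure \<rho>; k = (\<lambda>x y. spin_inner x (\<psi> x) (Q x y (\<phi> y))) in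
        double_integral_exists \<mu> (\<lambda>x y. of_real (layer_weight \<eta> t x y) * k x y) \<and>
        double_integral_exists \<mu> (\<lambda>x y. of_real (theta \<eta> t x) * k x y) \<and>
        double_integral_exists \<mu> (\<lambda>x y. of_real (theta \<eta> t y) * k x y) \<and>
        ((\<lambda>s. layer_form \<rho> \<eta> Q s \<psi> \<phi>) has_vector_derivative
          - 2 * \<i> * (LINT x|\<mu>. LINT y|\<mu>. of_real (deriv (\<lambda>s. layer_weight \<eta> s x y) t) * k x y)) (at t)))"

text \<open>
  Integrability expresses that the right side of the inequality is finite; the surface layer form
  is real-valued on the diagonal by symmetry of the kernel.
\<close>

definition hyperbolicity_condition ::
  "'h::separable_complex_hilbert opr measure \<Rightarrow> (real \<Rightarrow> 'h opr \<Rightarrow> real) \<Rightarrow> 'h kernel \<Rightarrow> 'h wave set \<Rightarrow> bool" where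
  "hyperbolicity_condition \<rho> \<eta> Q Cvary \<longleftrightarrow>
    (\<forall>t0 tmax. \<exists>C>0. \<forall>t\<in>{t0..tmax}. \<forall>\<psi>\<in>Cvary \<inter> L2_loc_t \<rho> \<eta>.
       integrable (leaf_measure \<rho> \<eta> t) (\<lambda>x. Re (spin_scalar x (\<psi> x) (\<psi> x))) \<and>
       Re (layer_form \<rho> \<eta> Q t \<psi> \<psi>)
         \<ge> 1 / C\<^sup>2 * (LINT x|leaf_measure \<rho> \<eta> t. Re (spin_scalar x (\<psi> x) (\<psi> x))))"

end

theory Submission
  imports Defs
begin

text \<open>
  The weight of the surface layer form is \<open>\<eta>\<^sub>t(x) - \<eta>\<^sub>t(y)\<close>.  For a wave function \<open>\<delta>\<close> the time
  derivative of \<open>\<langle>\<delta>|\<delta>\<rangle>\<^sup>t\<close> is therefore \<open>-2i (A - A\<^sup>*)\<close>, where \<open>A\<close> is the integral of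
  \<open>\<theta>\<^sub>t(x) \<prec>\<delta>(x)|(Q\<delta>)(x) - c\<delta>(x)\<succ>\<close>.  If \<open>Q\<delta> = 0\<close> in the strip, then \<open>A\<close> is
  real and the form is conserved there.  Apply this to the difference
  \<open>\<delta>\<close> of the two solutions.  Its form vanishes initially by the parallelogram law, since the
  form is nonnegative on the sum and on the difference.  By hyperbolicity, \<open>\<theta>\<^sub>t \<delta> = 0\<close> almost
  everywhere for every \<open>t \<in> I\<close>; as \<open>\<theta>\<close> is continuous in time, rational \<open>t\<close> suffice to cover all
  points with \<open>\<eta>\<^sub>I > 0\<close>.
\<close>

section \<open>Scalar product\<close>

lemma cinner_scaleC_left: "cinner (c *\<^sub>C u) v = cnj c * cinner u v"
  by (metis cinner_commute cinner_scaleC_right complex_cnj_mult)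

lemma cinner_add_left: "cinner (u + v) w = cinner u w + cinner v w"
  by (metis cinner_add_right cinner_commute complex_cnj_add)

lemma cinner_scaleR_right: "cinner u (r *\<^sub>R v) = of_real r * cinner u v"
  by (metis cinner_scaleC_right scaleC_of_real)

lemma cinner_scaleR_left: "cinner (r *\<^sub>R u) v = of_real r * cinner u v"
  by (metis complex_cnj_complex_of_real cinner_scaleC_left scaleC_of_real)

lemma cinner_minus_right: "cinner u (- v) = - cinner u v"
  using cinner_scaleR_right[of u "-1" v] by simp

lemma cinner_minus_left: "cinner (- u) v = - cinner u v"
  using cinner_scaleR_left[of "-1" u v] by simp

lemma cinner_diff_right: "cinner u (v - w) = cinner u v - cinner u w"
  using cinner_add_right[of u v "- w"] by (simp add: cinner_minus_right)

lemma cinner_diff_left: "cinner (u - v) w = cinner u w - cinner v w"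
  using cinner_add_left[of u "- v" w] by (simp add: cinner_minus_left)

lemma cinner_zero [simp]: "cinner u 0 = 0" "cinner 0 u = 0"
  using cinner_scaleR_right[of u 0 u] cinner_scaleR_left[of 0 u u] by simp_all

lemmas cinner_simps =
  cinner_add_left cinner_add_right cinner_diff_left cinner_diff_right
  cinner_scaleR_left cinner_scaleR_right cinner_minus_left cinner_minus_right

lemma Re_cinner_self: "Re (cinner u u) = (norm u)\<^sup>2"
proof -
  have "0 \<le> Re (cinner u u)"
    by (metis norm_eq_sqrt_cinner norm_ge_zero real_sqrt_ge_0_iff)
  then show ?thesis
    by (simp add: norm_eq_sqrt_cinner)
qed

lemma Re_cinner_commute: "Re (cinner u v) = Re (cinner v u)"
  by (subst cinner_commute) simp

text \<open>The class already provides the triangle inequality for the norm, so Cauchy-Schwarz is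
  read off from it by expanding squares, reversing the usual order of deduction.\<close>

lemma Re_cinner_le: "Re (cinner u v) \<le> norm u * norm v"
proof -
  have "(norm (u + v))\<^sup>2 \<le> (norm u + norm v)\<^sup>2"
    by (simp add: norm_triangle_ineq power_mono)
  moreover have "(norm (u + v))\<^sup>2 = (norm u)\<^sup>2 + 2 * Re (cinner u v) + (norm v)\<^sup>2"
    by (simp add: cinner_simps Re_cinner_commute[of v u] flip: Re_cinner_self)
  ultimately show ?thesis
    by (simp add: power2_sum)
qed

lemma norm_scaleC: "norm (c *\<^sub>C u) = cmod c * norm u"
proof -
  have "cinner (c *\<^sub>C u) (c *\<^sub>C u) = of_real ((cmod c)\<^sup>2) * cinner u u"
    unfolding complex_norm_square by (simp add: cinner_scaleC_left cinner_scaleC_right ac_simps)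
  then have "Re (cinner (c *\<^sub>C u) (c *\<^sub>C u)) = (cmod c)\<^sup>2 * Re (cinner u u)"
    by (simp del: of_real_power)
  then have "(norm (c *\<^sub>C u))\<^sup>2 = (cmod c * norm u)\<^sup>2"
    by (simp add: power_mult_distrib Re_cinner_self)
  then show ?thesis
    by (simp add: power2_eq_iff_nonneg)
qed

text \<open>Real and imaginary parts are bounded separately, the latter by rotating \<open>v\<close>
  with \<open>\<i>\<close> and \<open>- \<i>\<close>. The constant 2 is not sharp, but it is enough
  for continuity of the scalar product.\<close>

lemma norm_cinner_le: "norm (cinner u v) \<le> 2 * (norm u * norm v)"
proof -
  have "\<bar>Re (cinner u v)\<bar> \<le> norm u * norm v"
    using Re_cinner_le[of u v] Re_cinner_le[of u "- v"] by (simp add: cinner_simps)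
  moreover have "\<bar>Im (cinner u v)\<bar> \<le> norm u * norm v"
    using Re_cinner_le[of u "\<i> *\<^sub>C v"] Re_cinner_le[of u "(- \<i>) *\<^sub>C v"]
    by (simp add: cinner_scaleC_right norm_scaleC del: complex_vector.scale_minus_left)
  ultimately show ?thesis
    using cmod_le[of "cinner u v"] by linarith
qed

lemma bounded_linear_cinner_right: "bounded_linear (cinner u)"
  by (rule bounded_linear_intro[where K = "2 * norm u"])
    (use norm_cinner_le[of u] in \<open>simp_all add: cinner_simps scaleR_conv_of_real ac_simps\<close>)

lemma bounded_linear_cinner_left: "bounded_linear (\<lambda>u. cinner u v)"
  by (rule bounded_linear_intro[where K = "2 * norm v"])
    (use norm_cinner_le[of _ v] in \<open>simp_all add: cinner_simps scaleR_conv_of_real ac_simps\<close>)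

section \<open>Positive square roots of bounded operators\<close>

text \<open>Positivity is tested on the vector \<open>N *\<^sub>R u - T u\<close> with
  \<open>N = norm T\<close>. In the expansion, the term quadratic in \<open>v = T u\<close> is at
  most \<open>N * (norm v)\<^sup>2\<close>, which uses up half of the mixed terms.\<close>

lemma positive_op_norm_bound:
  assumes "positive_op T"
  shows "(norm (T u))\<^sup>2 \<le> norm T * Re (cinner u (T u))"
proof (cases "norm T = 0")
  case False
  define N where "N = norm T"
  have N: "0 < N" using False by (simp add: N_def)
  define v where "v = T u"
  have sa: "cinner (T p) q = cinner p (T q)" for p q
    using assms by (simp add: positive_op_def selfadjoint_def)
  have "Re (cinner v (T v)) \<le> norm v * (N * norm v)"
    by (rule order_trans[OF Re_cinner_le])
      (simp add: N_def mult_left_mono norm_blinfun)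
  then have "Re (cinner v (T v)) \<le> N * (norm v)\<^sup>2"
    by (simp add: power2_eq_square ac_simps)
  moreover have "0 \<le> Re (cinner (N *\<^sub>R u - v) (T (N *\<^sub>R u - v)))"
    using assms by (simp add: positive_op_def)
  moreover have "cinner u (T v) = cinner v v"
    by (simp add: v_def sa)
  ultimately have "0 \<le> N * N * Re (cinner u v) - N * (norm v)\<^sup>2"
    by (simp add: blinfun.diff_right blinfun.scaleR_right cinner_simps Re_cinner_self
        algebra_simps flip: v_def)
  then have "N * (norm v)\<^sup>2 \<le> N * (N * Re (cinner u v))"
    by simp
  then show ?thesis
    using N by (simp add: v_def N_def)
qed simp

lemma positive_op_eq_0:
  assumes "positive_op T" "Re (cinner u (T u)) = 0"
  shows "T u = 0"
  using positive_op_norm_bound[OF assms(1), of u] assms(2) by simp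

lemma selfadjointD: "selfadjoint T \<Longrightarrow> cinner (T u) v = cinner u (T v)"
  by (simp add: selfadjoint_def)

lemma selfadjoint_tendsto:
  assumes "S \<longlonglongrightarrow> T" "\<And>k. selfadjoint (S k)"
  shows "selfadjoint T"
  unfolding selfadjoint_def
proof (intro allI)
  fix u v
  have 1: "(\<lambda>k. cinner (S k u) v) \<longlonglongrightarrow> cinner (T u) v"
    by (intro bounded_linear.tendsto[OF bounded_linear_cinner_left]
        bounded_linear.tendsto[OF blinfun.bounded_linear_left] assms)
  have 2: "(\<lambda>k. cinner u (S k v)) \<longlonglongrightarrow> cinner u (T v)"
    by (intro bounded_linear.tendsto[OF bounded_linear_cinner_right]
        bounded_linear.tendsto[OF blinfun.bounded_linear_left] assms)
  show "cinner (T u) v = cinner u (T v)"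
    using LIMSEQ_unique[OF 1] 2 assms(2) by (simp add: selfadjoint_def)
qed

text \<open>
  The iteration \<open>S \<mapsto> (R + S\<^sup>2) / 2\<close> for a fixed point of \<open>2 S = R + S\<^sup>2\<close>, i.e.
  \<open>(1 - S)\<^sup>2 = 1 - R\<close>, is dominated by the scalar iteration with \<open>R = 1\<close>, which increases to \<open>1\<close>.
\<close>

primrec sqrt_iter :: "'h::separable_complex_hilbert opr \<Rightarrow> nat \<Rightarrow> 'h opr" where
  "sqrt_iter R 0 = 0"
| "sqrt_iter R (Suc k) = (1/2) *\<^sub>R (R + (sqrt_iter R k o\<^sub>L sqrt_iter R k))"

primrec sqrt_majorant :: "nat \<Rightarrow> real" where
  "sqrt_majorant 0 = 0"
| "sqrt_majorant (Suc k) = (1 + (sqrt_majorant k)\<^sup>2) / 2"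

lemma sqrt_majorant_bounds: "0 \<le> sqrt_majorant k" "sqrt_majorant k \<le> 1"
proof (induction k)
  case (Suc k)
  { case 1 show ?case by simp }
  { case 2 show ?case using Suc by (simp add: power_le_one) }
qed simp_all

lemma sqrt_majorant_mono: "sqrt_majorant k \<le> sqrt_majorant (Suc k)"
  using zero_le_power2[of "1 - sqrt_majorant k"] by (simp add: power2_diff)

lemma sqrt_iter_norm_le:
  assumes "norm R \<le> 1"
  shows "norm (sqrt_iter R k) \<le> sqrt_majorant k"
proof (induction k)
  case (Suc k)
  have "norm (sqrt_iter R k o\<^sub>L sqrt_iter R k) \<le> (sqrt_majorant k)\<^sup>2"
    unfolding power2_eq_square
    by (rule order_trans[OF norm_blinfun_compose mult_mono]) (use Suc sqrt_majorant_bounds in auto)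
  then have "norm (R + (sqrt_iter R k o\<^sub>L sqrt_iter R k)) \<le> 1 + (sqrt_majorant k)\<^sup>2"
    using add_mono[OF assms] norm_triangle_le by blast
  then show ?case by simp
qed simp

text \<open>The bound telescopes, which is what makes the operator increments summable. The
  induction closes because \<open>(a + b) * (a - b)\<close> is again a difference of squares,
  matching the scalar recursion.\<close>

lemma sqrt_iter_diff_le:
  assumes "norm R \<le> 1"
  shows "norm (sqrt_iter R (Suc k) - sqrt_iter R k) \<le> sqrt_majorant (Suc k) - sqrt_majorant k"
proof (induction k)
  case 0
  then show ?case using assms by simp
next
  case (Suc k)
  define A where "A = sqrt_iter R (Suc k)"
  define B where "B = sqrt_iter R k"
  define a where "a = sqrt_majorant (Suc k)"
  define b where "b = sqrt_majorant k"
  have ab: "norm A \<le> a" "norm B \<le> b" "norm (A - B) \<le> a - b"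
    using sqrt_iter_norm_le[OF assms] Suc by (simp_all only: A_def B_def a_def b_def)
  have "b \<le> a"
    using sqrt_majorant_mono by (simp only: a_def b_def)
  have "sqrt_iter R (Suc (Suc k)) = (1/2) *\<^sub>R (R + (A o\<^sub>L A))"
    by (simp add: A_def)
  moreover have "A = (1/2) *\<^sub>R (R + (B o\<^sub>L B))"
    by (simp add: A_def B_def)
  ultimately have "sqrt_iter R (Suc (Suc k)) - A = (1/2) *\<^sub>R ((R + (A o\<^sub>L A)) - (R + (B o\<^sub>L B)))"
    by (metis scaleR_diff_right)
  \<comment> \<open>This factorization respects the order of composition and so holds for arbitrary
    operators \<open>A\<close> and \<open>B\<close>.\<close>
  also have "(R + (A o\<^sub>L A)) - (R + (B o\<^sub>L B)) = (A o\<^sub>L (A - B)) + ((A - B) o\<^sub>L B)"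
    by (intro blinfun_eqI) (simp add: blinfun.diff_left blinfun.add_left blinfun.diff_right)
  finally have "norm (sqrt_iter R (Suc (Suc k)) - A)
      = (1/2) * norm ((A o\<^sub>L (A - B)) + ((A - B) o\<^sub>L B))"
    by simp
  also have "\<dots> \<le> (1/2) * (a * (a - b) + (a - b) * b)"
    using ab \<open>b \<le> a\<close> by (intro mult_left_mono norm_triangle_le add_mono
        order_trans[OF norm_blinfun_compose mult_mono])
      (auto intro: order_trans[OF norm_ge_zero])
  also have "\<dots> = (1 + a\<^sup>2) / 2 - (1 + b\<^sup>2) / 2"
    by (simp add: field_simps power2_eq_square)
  also have "\<dots> = sqrt_majorant (Suc (Suc k)) - a"
    by (simp add: a_def b_def)
  finally show ?case
    unfolding A_def a_def .
qed

text \<open>The majorant is bounded and increasing, so its increments are summable. They dominate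
  the operator increments, and completeness of the operator space yields the limit.\<close>

lemma sqrt_iter_convergent:
  assumes "norm R \<le> 1"
  shows "convergent (sqrt_iter R)"
proof -
  have "convergent sqrt_majorant"
    by (intro Bseq_mono_convergent BseqI'[where K = 1] incseq_SucI monoI)
      (use sqrt_majorant_bounds sqrt_majorant_mono lift_Suc_mono_le[of sqrt_majorant] in auto)
  then have "summable (\<lambda>k. sqrt_majorant (Suc k) - sqrt_majorant k)"
    using telescope_summable convergentD by (metis convergent_def)
  then have "summable (\<lambda>k. sqrt_iter R (Suc k) - sqrt_iter R k)"
    by (rule summable_comparison_test[rotated]) (use sqrt_iter_diff_le[OF assms] in blast)
  then have "convergent (\<lambda>n. \<Sum>k<n. sqrt_iter R (Suc k) - sqrt_iter R k)"
    by (simp add: summable_iff_convergent)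
  moreover have "(\<Sum>k<n. sqrt_iter R (Suc k) - sqrt_iter R k) = sqrt_iter R n" for n
    using sum_lessThan_telescope[of "sqrt_iter R" n] by simp
  ultimately show ?thesis
    by (simp del: sqrt_iter.simps)
qed

lemma selfadjoint_sqrt_iter:
  assumes "selfadjoint R"
  shows "selfadjoint (sqrt_iter R k)"
proof (induction k)
  case (Suc k)
  then show ?case
    using assms by (simp add: selfadjoint_def blinfun.scaleR_left blinfun.add_left cinner_simps)
qed (simp add: selfadjoint_def)

text \<open>Every iterate is a polynomial in \<open>R\<close>. Commutation survives the limit and is
  the key to uniqueness of the square root.\<close>

lemma sqrt_iter_commute:
  assumes "A o\<^sub>L R = R o\<^sub>L A"
  shows "A o\<^sub>L sqrt_iter R k = sqrt_iter R k o\<^sub>L A"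
proof (induction k)
  case (Suc k)
  have 1: "A (R u) = R (A u)" for u
    using arg_cong[OF assms, of "\<lambda>T. T u"] by simp
  have 2: "A (sqrt_iter R k u) = sqrt_iter R k (A u)" for u
    using arg_cong[OF Suc, of "\<lambda>T. T u"] by simp
  show ?case
    by (intro blinfun_eqI)
      (simp add: 1 2 blinfun.scaleR_left blinfun.scaleR_right blinfun.add_left blinfun.add_right)
qed simp

text \<open>With \<open>R = 1 - T\<close>, the limit \<open>S\<close> of the iteration satisfies
  \<open>2 S = R + S o S\<close>, so \<open>P = 1 - S\<close> squares to \<open>1 - R = T\<close>.
  Positivity of \<open>P\<close> comes from \<open>norm S \<le> 1\<close>, and commutation with
  \<open>T\<close> passes to \<open>R\<close>, to the iterates and to \<open>S\<close>.\<close>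

lemma positive_sqrt_exists_contraction:
  fixes T :: "'h::separable_complex_hilbert opr"
  assumes T: "positive_op T" "norm T \<le> 1"
  shows "\<exists>S. positive_op S \<and> S o\<^sub>L S = T \<and> (\<forall>A. A o\<^sub>L T = T o\<^sub>L A \<longrightarrow> A o\<^sub>L S = S o\<^sub>L A)"
proof -
  define R where "R = id_blinfun - T"
  have saT: "cinner (T u) v = cinner u (T v)" for u v
    using T by (simp add: positive_op_def selfadjoint_def)
  have saR: "selfadjoint R"
    by (simp add: selfadjoint_def R_def blinfun.diff_left cinner_simps saT)
  \<comment> \<open>Since \<open>norm T \<le> 1\<close>, the square of \<open>norm (T u)\<close> is
    at most the expectation value of \<open>T\<close> in \<open>u\<close>, so in the expansion the
    negative mixed term outweighs it.\<close>
  have "norm (R u) \<le> norm u" for u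
  proof (rule power2_le_imp_le)
    have pos: "0 \<le> Re (cinner u (T u))"
      using T by (simp add: positive_op_def)
    have "(norm (R u))\<^sup>2 = (norm u)\<^sup>2 - 2 * Re (cinner u (T u)) + (norm (T u))\<^sup>2"
      using Re_cinner_commute[of u "T u"]
      by (simp add: R_def blinfun.diff_left cinner_simps flip: Re_cinner_self)
    moreover have "(norm (T u))\<^sup>2 \<le> 1 * Re (cinner u (T u))"
      by (rule order_trans[OF positive_op_norm_bound mult_right_mono]) (use T pos in auto)
    ultimately show "(norm (R u))\<^sup>2 \<le> (norm u)\<^sup>2"
      using pos by linarith
  qed simp
  then have nR: "norm R \<le> 1"
    by (intro norm_blinfun_bound) auto
  obtain S where S: "sqrt_iter R \<longlonglongrightarrow> S"
    using sqrt_iter_convergent[OF nR] convergent_def by blast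
  have comp: "(\<lambda>k. sqrt_iter R k o\<^sub>L sqrt_iter R k) \<longlonglongrightarrow> (S o\<^sub>L S)"
    by (rule bounded_bilinear.tendsto[OF bounded_bilinear_blinfun_compose S S])
  have "(\<lambda>k. sqrt_iter R (Suc k)) \<longlonglongrightarrow> (1/2) *\<^sub>R (R + (S o\<^sub>L S))"
    using tendsto_scaleR[OF tendsto_const tendsto_add[OF tendsto_const comp]] by simp
  then have fix_S: "S = (1/2) *\<^sub>R (R + (S o\<^sub>L S))"
    using LIMSEQ_unique LIMSEQ_Suc[OF S] by blast
  have saS: "selfadjoint S"
    by (rule selfadjoint_tendsto[OF S selfadjoint_sqrt_iter[OF saR]])
  have nS: "norm S \<le> 1"
    by (rule LIMSEQ_le_const2[OF tendsto_norm[OF S]])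
      (use order_trans[OF sqrt_iter_norm_le[OF nR] sqrt_majorant_bounds(2)] in blast)
  define P where "P = id_blinfun - S"
  have "positive_op P"
    unfolding positive_op_def
  proof safe
    show "selfadjoint P"
      using saS by (simp add: selfadjoint_def P_def blinfun.diff_left cinner_simps)
    fix u
    have "norm (S u) \<le> 1 * norm u"
      by (rule order_trans[OF norm_blinfun mult_right_mono[OF nS]]) simp
    then have "Re (cinner u (S u)) \<le> norm u * norm u"
      by (intro order_trans[OF Re_cinner_le mult_left_mono]) simp_all
    then show "0 \<le> Re (cinner u (P u))"
      by (simp add: P_def blinfun.diff_left cinner_simps Re_cinner_self power2_eq_square)
  qed
  moreover have "P o\<^sub>L P = T"
  proof (rule blinfun_eqI)
    fix u
    have "2 *\<^sub>R S u = R u + S (S u)"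
      by (subst fix_S) (simp add: blinfun.scaleR_left blinfun.add_left)
    then show "(P o\<^sub>L P) u = T u"
      by (simp add: P_def R_def blinfun.diff_left blinfun.diff_right scaleR_2 algebra_simps)
  qed
  moreover have "A o\<^sub>L P = P o\<^sub>L A" if "A o\<^sub>L T = T o\<^sub>L A" for A
  proof -
    have "A (T u) = T (A u)" for u
      using arg_cong[OF that, of "\<lambda>X. X u"] by simp
    then have "A o\<^sub>L R = R o\<^sub>L A"
      by (intro blinfun_eqI) (simp add: R_def blinfun.diff_left blinfun.diff_right)
    then have "(\<lambda>k. A o\<^sub>L sqrt_iter R k) = (\<lambda>k. sqrt_iter R k o\<^sub>L A)"
      by (simp add: sqrt_iter_commute)
    moreover have "(\<lambda>k. A o\<^sub>L sqrt_iter R k) \<longlonglongrightarrow> (A o\<^sub>L S)"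
      by (rule bounded_bilinear.tendsto[OF bounded_bilinear_blinfun_compose tendsto_const S])
    moreover have "(\<lambda>k. sqrt_iter R k o\<^sub>L A) \<longlonglongrightarrow> (S o\<^sub>L A)"
      by (rule bounded_bilinear.tendsto[OF bounded_bilinear_blinfun_compose S tendsto_const])
    ultimately have "A o\<^sub>L S = S o\<^sub>L A"
      using LIMSEQ_unique by metis
    then have "A (S u) = S (A u)" for u
      by (metis blinfun_apply_blinfun_compose)
    then show ?thesis
      by (intro blinfun_eqI) (simp add: P_def blinfun.diff_left blinfun.diff_right)
  qed
  ultimately show ?thesis by blast
qed

lemma positive_op_scaleR:
  assumes "positive_op T" "0 \<le> r"
  shows "positive_op (r *\<^sub>R T)"
  using assms by (simp add: positive_op_def selfadjoint_def blinfun.scaleR_left cinner_simps)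

lemma positive_sqrt_exists:
  assumes T: "positive_op T"
  shows "\<exists>S. positive_op S \<and> S o\<^sub>L S = T \<and> (\<forall>A. A o\<^sub>L T = T o\<^sub>L A \<longrightarrow> A o\<^sub>L S = S o\<^sub>L A)"
proof -
  \<comment> \<open>Rescaling by \<open>r\<close> reduces to contractions; the summand 1 keeps the
    division legitimate for \<open>T = 0\<close>.\<close>
  define r where "r = norm T + 1"
  have r: "0 < r" by (simp add: r_def add_nonneg_pos)
  have "positive_op ((1/r) *\<^sub>R T)" "norm ((1/r) *\<^sub>R T) \<le> 1"
    using r T by (auto intro!: positive_op_scaleR simp: r_def)
  then obtain S where S: "positive_op S" "S o\<^sub>L S = (1/r) *\<^sub>R T"
    and comm: "\<And>A. A o\<^sub>L ((1/r) *\<^sub>R T) = ((1/r) *\<^sub>R T) o\<^sub>L A \<Longrightarrow> A o\<^sub>L S = S o\<^sub>L A"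
    using positive_sqrt_exists_contraction by blast
  note bil = bounded_bilinear.scaleR_left[OF bounded_bilinear_blinfun_compose]
    bounded_bilinear.scaleR_right[OF bounded_bilinear_blinfun_compose]
  have "positive_op (sqrt r *\<^sub>R S)"
    using S r by (simp add: positive_op_scaleR)
  moreover have "(sqrt r *\<^sub>R S) o\<^sub>L (sqrt r *\<^sub>R S) = T"
    using S r by (simp add: bil)
  moreover have "A o\<^sub>L (sqrt r *\<^sub>R S) = (sqrt r *\<^sub>R S) o\<^sub>L A" if "A o\<^sub>L T = T o\<^sub>L A" for A
    using comm[of A] that by (simp add: bil)
  ultimately show ?thesis by blast
qed

text \<open>The competitor \<open>S'\<close> commutes with its own square \<open>T\<close>, hence
  with \<open>S\<close>. So \<open>S + S'\<close> annihilates the range of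
  \<open>D = S - S'\<close>; pairing with \<open>D u\<close> splits this into two nonnegative terms,
  both zero. Then \<open>S\<close> and \<open>S'\<close> each annihilate \<open>D u\<close>, so
  \<open>D (D u) = 0\<close>, and selfadjointness of \<open>D\<close> gives \<open>D u = 0\<close>.
  This makes the description in \<open>op_sqrt\<close> meaningful.\<close>

lemma positive_sqrt_unique:
  assumes S: "positive_op S" "S o\<^sub>L S = T"
    and comm: "\<And>A. A o\<^sub>L T = T o\<^sub>L A \<Longrightarrow> A o\<^sub>L S = S o\<^sub>L A"
    and S': "positive_op S'" "S' o\<^sub>L S' = T"
  shows "S' = S"
proof (rule blinfun_eqI)
  fix u
  define D where "D = S - S'"
  have "S' o\<^sub>L T = T o\<^sub>L S'"
    unfolding S'(2)[symmetric] by (intro blinfun_eqI) simp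
  then have "S' o\<^sub>L S = S o\<^sub>L S'" by (rule comm)
  then have SS: "S' (S v) = S (S' v)" for v
    by (metis blinfun_apply_blinfun_compose)
  have sq: "S (S v) = S' (S' v)" for v
    using S(2) S'(2) by (metis blinfun_apply_blinfun_compose)
  have "S (D u) + S' (D u) = 0"
    by (simp add: D_def blinfun.diff_left blinfun.diff_right SS sq)
  then have "Re (cinner (D u) (S (D u))) + Re (cinner (D u) (S' (D u))) = 0"
    by (simp flip: cinner_add_right plus_complex.sel)
  moreover have "0 \<le> Re (cinner (D u) (S (D u)))" "0 \<le> Re (cinner (D u) (S' (D u)))"
    using S(1) S'(1) by (simp_all add: positive_op_def)
  ultimately have "Re (cinner (D u) (S (D u))) = 0" "Re (cinner (D u) (S' (D u))) = 0"
    by linarith+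
  then have "S (D u) = 0" "S' (D u) = 0"
    using S(1) S'(1) positive_op_eq_0 by blast+
  then have "D (D u) = 0"
    by (simp add: D_def blinfun.diff_left)
  moreover have "cinner (D u) (D u) = cinner u (D (D u))"
    using S(1) S'(1)
    by (simp add: D_def blinfun.diff_left blinfun.diff_right cinner_simps positive_op_def
        selfadjointD)
  ultimately have "D u = 0"
    using Re_cinner_self[of "D u"] by simp
  then show "S' u = S u"
    by (simp add: D_def blinfun.diff_left)
qed

lemma op_sqrt:
  assumes "positive_op T"
  shows "positive_op (op_sqrt T)" "op_sqrt T o\<^sub>L op_sqrt T = T"
proof -
  have "\<exists>!S. positive_op S \<and> S o\<^sub>L S = T"
    using positive_sqrt_exists[OF assms] positive_sqrt_unique by metis
  from theI'[OF this] show "positive_op (op_sqrt T)" "op_sqrt T o\<^sub>L op_sqrt T = T"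
    by (auto simp: op_sqrt_def)
qed

lemma op_abs:
  assumes "selfadjoint x"
  shows "positive_op (op_abs x)" "op_abs x o\<^sub>L op_abs x = x o\<^sub>L x"
proof -
  have "cinner (x (x u)) v = cinner (x u) (x v)" "cinner u (x (x v)) = cinner (x u) (x v)" for u v
    using assms by (simp_all add: selfadjoint_def)
  then have "positive_op (x o\<^sub>L x)"
    by (simp add: positive_op_def selfadjoint_def Re_cinner_self)
  then show "positive_op (op_abs x)" "op_abs x o\<^sub>L op_abs x = x o\<^sub>L x"
    by (auto simp: op_abs_def op_sqrt)
qed

text \<open>Moving one selfadjoint root of \<open>op_abs x\<close> to the other side links the spin
  scalar product to the function whose continuity and measurability are prescribed for wave
  functions.\<close>

lemma Re_spin_scalar_self:
  assumes "selfadjoint x"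
  shows "Re (spin_scalar x u u) = (norm (op_sqrt (op_abs x) u))\<^sup>2"
proof -
  note S = op_sqrt[OF op_abs(1)[OF assms]]
  have "op_abs x u = op_sqrt (op_abs x) (op_sqrt (op_abs x) u)"
    using S(2) by (metis blinfun_apply_blinfun_compose)
  moreover have "selfadjoint (op_sqrt (op_abs x))"
    using S(1) by (simp add: positive_op_def)
  ultimately show ?thesis
    using selfadjointD[of "op_sqrt (op_abs x)" u] by (simp add: spin_scalar_def flip: Re_cinner_self)
qed

text \<open>The absolute value of \<open>x\<close> has the same kernel as \<open>x\<close>, and for
  selfadjoint \<open>x\<close> this kernel is orthogonal to the range. Definiteness therefore holds
  on the spin space.\<close>

lemma spin_scalar_eq_0:
  assumes x: "selfadjoint x" and u: "u \<in> spin_space x" and "Re (spin_scalar x u u) = 0"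
  shows "u = 0"
proof -
  have "op_abs x u = 0"
    using assms op_abs(1) positive_op_eq_0 by (auto simp: spin_scalar_def)
  then have "x (x u) = 0"
    using op_abs(2)[OF x] by (metis blinfun.zero_right blinfun_apply_blinfun_compose)
  then have "x u = 0"
    using selfadjointD[OF x, of u "x u"] Re_cinner_self[of "x u"] by simp
  moreover obtain v where "u = x v"
    using u by (auto simp: spin_space_def)
  ultimately show "u = 0"
    using selfadjointD[OF x, of v u] Re_cinner_self[of u] by simp
qed

section \<open>Time functions\<close>

text \<open>\<open>smooth_on\<close> only provides local extensions \<open>g\<close> to open sets;
  their continuity is carried over to the original function here.\<close>

lemma continuous_within_cong_open:
  assumes "open U" "p \<in> U" "p \<in> S" "continuous_on U g" "\<And>q. q \<in> U \<inter> S \<Longrightarrow> g q = f q"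
  shows "continuous (at p within S) f"
proof -
  have "continuous (at p within S) g"
    using assms(1,2,4) by (simp add: continuous_on_eq_continuous_at continuous_at_imp_continuous_at_within)
  moreover have "\<forall>\<^sub>F q in at p within S. g q = f q"
    unfolding eventually_at_topological using assms by auto
  ultimately show ?thesis
    using assms(2,3,5) unfolding continuous_within by (auto elim: Lim_transform_eventually)
qed

lemma smooth_on_continuous_on:
  assumes "smooth_on S f"
  shows "continuous_on S f"
  unfolding continuous_on_eq_continuous_within
proof
  fix p assume "p \<in> S"
  then obtain U h where U: "open U" "p \<in> U" "\<And>k. Ck_on k U h" "\<And>x. x \<in> U \<inter> S \<Longrightarrow> h x = f x"
    using assms unfolding smooth_on_def by meson
  have "continuous_on U h"
    using U(3)[of 0] by simp
  then show "continuous (at p within S) f"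
    using U \<open>p \<in> S\<close> by (intro continuous_within_cong_open[of U p S h]) auto
qed

text \<open>The set \<open>UNIV \<times> M\<close> contains the whole time line through each point
  of \<open>M\<close>. The time derivative of a local extension, its Frechet derivative in direction
  \<open>(1, 0)\<close>, is therefore that of \<open>\<eta>\<close>, and it inherits continuity from
  the extension.\<close>

lemma smooth_on_partial_derivative:
  fixes \<eta> :: "real \<Rightarrow> 'a::real_normed_vector \<Rightarrow> real"
  assumes sm: "smooth_on (UNIV \<times> M) (\<lambda>(t, x). \<eta> t x)"
  shows has_real_derivative_theta:
      "x \<in> M \<Longrightarrow> ((\<lambda>s. \<eta> s x) has_real_derivative theta \<eta> t x) (at t)"
    and continuous_on_theta: "continuous_on (UNIV \<times> M) (\<lambda>(t, x). theta \<eta> t x)"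
proof -
  have *: "\<exists>U g. open U \<and> (t, x) \<in> U \<and> continuous_on U g \<and>
      (\<forall>s y. (s, y) \<in> U \<inter> UNIV \<times> M \<longrightarrow> ((\<lambda>s. \<eta> s y) has_real_derivative g (s, y)) (at s))"
    if x: "x \<in> M" for t x
  proof -
    obtain U h where U: "open U" "(t, x) \<in> U" "\<And>k. Ck_on k U h"
      and eq': "\<And>p. p \<in> U \<inter> UNIV \<times> M \<Longrightarrow> h p = (\<lambda>(t, x). \<eta> t x) p"
      using sm x unfolding smooth_on_def by (metis (no_types, lifting) SigmaI UNIV_I)
    have eq: "h (s, y) = \<eta> s y" if "(s, y) \<in> U" "y \<in> M" for s y
      using eq'[of "(s, y)"] that by simp
    have diff: "h differentiable (at p)" if "p \<in> U" for p
      using U(3)[of 1] that by simp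
    define g where "g p = frechet_derivative h (at p) (1, 0)" for p
    have "continuous_on U g"
      using U(3)[of 1] by (simp add: g_def)
    moreover have "((\<lambda>s. \<eta> s y) has_real_derivative g (s, y)) (at s)"
      if sy: "(s, y) \<in> U" "y \<in> M" for s y
    proof -
      have "(h has_derivative frechet_derivative h (at (s, y))) (at (s, y))"
        using diff[OF sy(1)] by (simp add: frechet_derivative_works)
      then have "((\<lambda>r. h (r, y)) has_derivative (\<lambda>v. frechet_derivative h (at (s, y)) (v, 0))) (at s)"
        by (rule has_derivative_compose[rotated, where f = "\<lambda>r. (r, y)"])
          (auto intro!: derivative_eq_intros)
      moreover have "frechet_derivative h (at (s, y)) (v, 0) = g (s, y) * v" for v
      proof -
        have "linear (frechet_derivative h (at (s, y)))"
          using diff[OF sy(1)] by (rule linear_frechet_derivative)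
        from linear_scale[OF this, of v "(1, 0)"] show ?thesis
          by (simp add: g_def)
      qed
      ultimately have "((\<lambda>r. h (r, y)) has_real_derivative g (s, y)) (at s)"
        by (simp add: has_field_derivative_def)
      \<comment> \<open>For fixed \<open>y\<close>, extension and \<open>\<eta>\<close> agree at all
        times near \<open>s\<close>, not just at \<open>s\<close>, so their derivatives agree as
        well.\<close>
      moreover have "open ((\<lambda>r. (r, y)) -` U)"
        by (intro open_vimage U continuous_intros)
      ultimately show ?thesis
        using sy eq by (auto elim!: has_field_derivative_transform_within_open)
    qed
    ultimately show ?thesis using U(1,2) by auto
  qed
  show "((\<lambda>s. \<eta> s x) has_real_derivative theta \<eta> t x) (at t)" if x: "x \<in> M"
  proof -
    obtain d where "((\<lambda>s. \<eta> s x) has_real_derivative d) (at t)"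
      using *[OF x, of t] x by blast
    then show ?thesis
      by (simp add: theta_def DERIV_imp_deriv)
  qed
  show "continuous_on (UNIV \<times> M) (\<lambda>(t, x). theta \<eta> t x)"
    unfolding continuous_on_eq_continuous_within
  proof
    fix p assume pM: "p \<in> (UNIV :: real set) \<times> M"
    moreover obtain t x where p: "p = (t, x)"
      by fastforce
    ultimately obtain U g where U: "open U" "p \<in> U" and g: "continuous_on U g"
      and d: "\<And>s y. (s, y) \<in> U \<Longrightarrow> y \<in> M \<Longrightarrow> ((\<lambda>s. \<eta> s y) has_real_derivative g (s, y)) (at s)"
      using *[of x t] by blast
    show "continuous (at p within UNIV \<times> M) (\<lambda>(t, x). theta \<eta> t x)"
      using U g d pM
      by (intro continuous_within_cong_open[of U p _ g]) (auto simp: theta_def intro!: DERIV_imp_deriv[symmetric])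
  qed
qed

lemma continuous_on_section:
  assumes "continuous_on (UNIV \<times> M) (\<lambda>(t, x). f t x)"
  shows "continuous_on M (f t)" "x \<in> M \<Longrightarrow> continuous_on UNIV (\<lambda>t. f t x)"
proof -
  have "continuous_on M (\<lambda>x. (\<lambda>(t, x). f t x) (t, x))"
    by (rule continuous_on_compose2[OF assms]) (auto intro!: continuous_intros)
  then show "continuous_on M (f t)" by simp
next
  assume "x \<in> M"
  then have "continuous_on UNIV (\<lambda>t. (\<lambda>(t, x). f t x) (t, x))"
    by (intro continuous_on_compose2[OF assms]) (auto intro!: continuous_intros)
  then show "continuous_on UNIV (\<lambda>t. f t x)" by simp
qed

section \<open>Spacetime integrals\<close>

text \<open>Restricting first to \<open>F\<close> and then to spacetime gives the trace of the Borel
  sets, for which continuous functions are measurable.\<close>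

lemma spacetime_measurable:
  assumes "sets \<rho> = sets (restrict_space borel F)" "continuous_on (spacetime \<rho>) f"
  shows "f \<in> borel_measurable (spacetime_measure \<rho>)"
proof -
  have "spacetime \<rho> \<subseteq> F"
    using sets_eq_imp_space_eq[OF assms(1)] by (auto simp: spacetime_def space_restrict_space)
  then have "sets (spacetime_measure \<rho>) = sets (restrict_space borel (spacetime \<rho>))"
    using sets_restrict_space_cong[OF assms(1)]
    by (simp add: sets_restrict_restrict_space Int_absorb1)
  then show ?thesis
    using borel_measurable_continuous_on_restrict[OF assms(2)] measurable_cong_sets by blast
qed

lemma space_spacetime_measure [simp]: "space (spacetime_measure \<rho>) = spacetime \<rho>"
  by (auto simp: space_restrict_space spacetime_def)

text \<open>
  An inner integral such as \<open>\<integral> (f\<^sub>1 + f\<^sub>2) dy\<close> agrees only almost everywhere with a measurable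
  function of \<open>x\<close> and might itself be non-measurable, since the measure need not be complete.
  The four double integrals are therefore kept apart.
\<close>

lemma double_integral_parallelogram:
  assumes "double_integral_exists \<mu> f1" "double_integral_exists \<mu> f2"
    "double_integral_exists \<mu> g1" "double_integral_exists \<mu> g2"
    and eq: "\<And>x y. x \<in> space \<mu> \<Longrightarrow> y \<in> space \<mu> \<Longrightarrow>
      f1 x y + f2 x y = 2 * (g1 x y + g2 x y)"
  shows "(LINT x|\<mu>. LINT y|\<mu>. f1 x y) + (LINT x|\<mu>. LINT y|\<mu>. f2 x y)
    = 2 * ((LINT x|\<mu>. LINT y|\<mu>. g1 x y) + (LINT x|\<mu>. LINT y|\<mu>. g2 x y))"
proof -
  note [simp] = assms(1-4)[unfolded double_integral_exists_def, THEN conjunct2, THEN conjunct1]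
  have "AE x in \<mu>. integrable \<mu> (f1 x)" "AE x in \<mu>. integrable \<mu> (f2 x)"
    "AE x in \<mu>. integrable \<mu> (g1 x)" "AE x in \<mu>. integrable \<mu> (g2 x)"
    using assms(1-4) by (simp_all add: double_integral_exists_def)
  then have "AE x in \<mu>. (LINT y|\<mu>. f1 x y) + (LINT y|\<mu>. f2 x y)
      = 2 * ((LINT y|\<mu>. g1 x y) + (LINT y|\<mu>. g2 x y))"
    using AE_space
  proof eventually_elim
    case (elim x)
    have "(LINT y|\<mu>. f1 x y) + (LINT y|\<mu>. f2 x y) = (LINT y|\<mu>. f1 x y + f2 x y)"
      using elim by simp
    also have "\<dots> = (LINT y|\<mu>. 2 * (g1 x y + g2 x y))"
      using elim eq by (intro Bochner_Integration.integral_cong) auto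
    finally show ?case
      using elim by simp
  qed
  then have "(LINT x|\<mu>. (LINT y|\<mu>. f1 x y) + (LINT y|\<mu>. f2 x y))
      = (LINT x|\<mu>. 2 * ((LINT y|\<mu>. g1 x y) + (LINT y|\<mu>. g2 x y)))"
    by (intro integral_cong_AE borel_measurable_add borel_measurable_const borel_measurable_times
        borel_measurable_integrable) simp_all
  then show ?thesis by simp
qed

section \<open>Square integrable wave functions\<close>

lemma norm_parallelogram:
  fixes u v :: "'h::separable_complex_hilbert"
  shows "(norm (u + v))\<^sup>2 + (norm (u - v))\<^sup>2 = 2 * ((norm u)\<^sup>2 + (norm v)\<^sup>2)"
  by (simp add: cinner_simps flip: Re_cinner_self)

text \<open>Continuity supplies measurability, and the pointwise bound supplies integrability in
  each strip, since the weight is nonnegative by monotonicity of \<open>\<eta>\<close> in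
  time.\<close>

lemma L2_loc_t_dominated:
  fixes \<rho> :: "'h::separable_complex_hilbert opr measure"
  assumes sets: "sets \<rho> = sets (restrict_space borel F)"
    and sa: "\<And>x. x \<in> spacetime \<rho> \<Longrightarrow> selfadjoint x"
    and cont: "\<And>t. continuous_on (spacetime \<rho>) (\<eta> t)"
    and mono: "\<And>s t x. x \<in> spacetime \<rho> \<Longrightarrow> s \<le> t \<Longrightarrow> \<eta> s x \<le> \<eta> t x"
    and \<psi>: "\<psi> \<in> L2_loc_t \<rho> \<eta>" and \<phi>: "\<phi> \<in> L2_loc_t \<rho> \<eta>"
    and \<delta>: "\<delta> \<in> continuous_wave_functions \<rho>"
    and dom: "\<And>x. x \<in> spacetime \<rho> \<Longrightarrow>
      Re (spin_scalar x (\<delta> x) (\<delta> x)) \<le> 2 * (Re (spin_scalar x (\<psi> x) (\<psi> x)) + Re (spin_scalar x (\<phi> x) (\<phi> x)))"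
  shows "\<delta> \<in> L2_loc_t \<rho> \<eta>"
proof -
  have strip: "time_strip \<rho> \<eta> a b \<subseteq> spacetime \<rho>" for a b
    by (auto simp: time_strip_def support_in_def)
  have w\<delta>: "\<delta> \<in> wave_functions_on (spacetime \<rho>)"
    and c\<delta>: "continuous_on (spacetime \<rho>) (\<lambda>x. op_sqrt (op_abs x) (\<delta> x))"
    using \<delta> by (auto simp: continuous_wave_functions_def)
  note meas = spacetime_measurable[OF sets c\<delta>]
  have "\<delta> \<in> L2_strip \<rho> \<eta> a b" if "a < b" for a b
    unfolding L2_strip_def
  proof (intro CollectI conjI)
    show "\<delta> \<in> wave_functions_on (time_strip \<rho> \<eta> a b)"
      using w\<delta> strip by (auto simp: wave_functions_on_def)
    show "(\<lambda>x. op_sqrt (op_abs x) (\<delta> x))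
        \<in> borel_measurable (restrict_space (spacetime_measure \<rho>) (time_strip \<rho> \<eta> a b))"
      by (rule measurable_restrict_space1[OF meas])
    let ?N = "\<lambda>\<xi> x. Re (spin_scalar x (\<xi> x) (\<xi> x))"
    let ?w = "\<lambda>x. \<eta> b x - \<eta> a x"
    have "integrable (spacetime_measure \<rho>) (\<lambda>x. ?N \<psi> x * ?w x)"
      "integrable (spacetime_measure \<rho>) (\<lambda>x. ?N \<phi> x * ?w x)"
      using \<psi> \<phi> that by (auto simp: L2_loc_t_def L2_strip_def)
    then have int: "integrable (spacetime_measure \<rho>) (\<lambda>x. 2 * (?N \<psi> x * ?w x + ?N \<phi> x * ?w x))"
      by (intro integrable_mult_right Bochner_Integration.integrable_add) auto
    show "integrable (spacetime_measure \<rho>) (\<lambda>x. ?N \<delta> x * ?w x)"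
    proof (rule Bochner_Integration.integrable_bound[OF int])
      have "(\<lambda>x. (norm (op_sqrt (op_abs x) (\<delta> x)))\<^sup>2 * ?w x) \<in> borel_measurable (spacetime_measure \<rho>)"
        using meas spacetime_measurable[OF sets cont] by measurable
      then show "(\<lambda>x. ?N \<delta> x * ?w x) \<in> borel_measurable (spacetime_measure \<rho>)"
        by (rule measurable_cong[THEN iffD1, rotated]) (simp add: Re_spin_scalar_self sa)
      show "AE x in spacetime_measure \<rho>. norm (?N \<delta> x * ?w x) \<le> norm (2 * (?N \<psi> x * ?w x + ?N \<phi> x * ?w x))"
      proof (rule AE_I2)
        fix x assume "x \<in> space (spacetime_measure \<rho>)"
        then have x: "x \<in> spacetime \<rho>" by simp
        have "0 \<le> ?w x" using mono[OF x, of a b] that by simp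
        moreover have "0 \<le> ?N \<delta> x" by (simp add: Re_spin_scalar_self sa x)
        ultimately have "0 \<le> ?N \<delta> x * ?w x" by simp
        moreover have "?N \<delta> x * ?w x \<le> (2 * (?N \<psi> x + ?N \<phi> x)) * ?w x"
          using dom[OF x] \<open>0 \<le> ?w x\<close> by (rule mult_right_mono)
        ultimately show "norm (?N \<delta> x * ?w x) \<le> norm (2 * (?N \<psi> x * ?w x + ?N \<phi> x * ?w x))"
          by (simp add: algebra_simps)
      qed
    qed
  qed
  then show ?thesis
    using w\<delta> by (simp add: L2_loc_t_def)
qed

text \<open>The parallelogram law holds pointwise for the spin scalar product. Dropping one of its
  two nonnegative left-hand terms leaves the domination of the other, with factor 2.\<close>

lemma
  fixes \<rho> :: "'h::separable_complex_hilbert opr measure"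
  assumes sets: "sets \<rho> = sets (restrict_space borel F)"
    and sa: "\<And>x. x \<in> spacetime \<rho> \<Longrightarrow> selfadjoint x"
    and cont: "\<And>t. continuous_on (spacetime \<rho>) (\<eta> t)"
    and mono: "\<And>s t x. x \<in> spacetime \<rho> \<Longrightarrow> s \<le> t \<Longrightarrow> \<eta> s x \<le> \<eta> t x"
    and L2: "\<psi> \<in> L2_loc_t \<rho> \<eta>" "\<phi> \<in> L2_loc_t \<rho> \<eta>"
  shows L2_loc_t_add: "(\<lambda>x. \<psi> x + \<phi> x) \<in> continuous_wave_functions \<rho> \<Longrightarrow> (\<lambda>x. \<psi> x + \<phi> x) \<in> L2_loc_t \<rho> \<eta>"
    and L2_loc_t_diff: "(\<lambda>x. \<psi> x - \<phi> x) \<in> continuous_wave_functions \<rho> \<Longrightarrow> (\<lambda>x. \<psi> x - \<phi> x) \<in> L2_loc_t \<rho> \<eta>"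
proof -
  have *: "Re (spin_scalar x (u + v) (u + v)) + Re (spin_scalar x (u - v) (u - v))
      = 2 * (Re (spin_scalar x u u) + Re (spin_scalar x v v))"
    "0 \<le> Re (spin_scalar x u u)" if "x \<in> spacetime \<rho>" for x u v
    using sa[OF that] norm_parallelogram
    by (simp_all add: Re_spin_scalar_self blinfun.add_right blinfun.diff_right)
  show "(\<lambda>x. \<psi> x + \<phi> x) \<in> L2_loc_t \<rho> \<eta>" if "(\<lambda>x. \<psi> x + \<phi> x) \<in> continuous_wave_functions \<rho>"
    by (rule L2_loc_t_dominated[OF sets sa cont mono L2 that]) (use * in \<open>smt (verit)\<close>)+
  show "(\<lambda>x. \<psi> x - \<phi> x) \<in> L2_loc_t \<rho> \<eta>" if "(\<lambda>x. \<psi> x - \<phi> x) \<in> continuous_wave_functions \<rho>"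
    by (rule L2_loc_t_dominated[OF sets sa cont mono L2 that]) (use * in \<open>smt (verit)\<close>)+
qed

section \<open>Surface layer form\<close>

lemma layer_weight_eq: "layer_weight \<eta> t x y = \<eta> t x - \<eta> t y"
  by (simp add: layer_weight_def algebra_simps)

lemma symmetric_kernel_diff:
  assumes "symmetric_kernel \<rho> Q" "x \<in> spacetime \<rho>" "y \<in> spacetime \<rho>"
    "u \<in> spin_space y" "v \<in> spin_space y"
  shows "Q x y (u - v) = Q x y u - Q x y v"
proof -
  have add: "\<And>u v. u \<in> spin_space y \<Longrightarrow> v \<in> spin_space y \<Longrightarrow> Q x y (u + v) = Q x y u + Q x y v"
    using assms(1-3) by (simp add: symmetric_kernel_def)
  have "u - v \<in> spin_space y"
    using assms(4,5) by (auto simp: spin_space_def simp flip: blinfun.diff_right)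
  from add[OF this assms(5)] show ?thesis by simp
qed

text \<open>The integrands obey the law pointwise, being additive in both wave functions with a
  common weight. It lets zero initial norms pass to the difference through diagonal values of the
  form alone, in place of a Cauchy-Schwarz inequality.\<close>

lemma layer_form_parallelogram:
  assumes Q: "symmetric_kernel \<rho> Q" and conv: "layer_form_conventions \<rho> \<eta> Q"
    and L2: "\<psi> \<in> L2_loc_t \<rho> \<eta>" "\<phi> \<in> L2_loc_t \<rho> \<eta>"
      "(\<lambda>x. \<psi> x + \<phi> x) \<in> L2_loc_t \<rho> \<eta>" "(\<lambda>x. \<psi> x - \<phi> x) \<in> L2_loc_t \<rho> \<eta>"
  shows "layer_form \<rho> \<eta> Q t (\<lambda>x. \<psi> x + \<phi> x) (\<lambda>x. \<psi> x + \<phi> x) + layer_form \<rho> \<eta> Q t (\<lambda>x. \<psi> x - \<phi> x) (\<lambda>x. \<psi> x - \<phi> x)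
    = 2 * (layer_form \<rho> \<eta> Q t \<psi> \<psi> + layer_form \<rho> \<eta> Q t \<phi> \<phi>)"
proof -
  define k where "k \<xi> x y = complex_of_real (layer_weight \<eta> t x y) * spin_inner x (\<xi> x) (Q x y (\<xi> y))"
    for \<xi> x y
  have ex: "double_integral_exists (spacetime_measure \<rho>) (k \<xi>)" if "\<xi> \<in> L2_loc_t \<rho> \<eta>" for \<xi>
    using conv that unfolding layer_form_conventions_def Let_def k_def by blast
  have wave: "\<psi> y \<in> spin_space y" "\<phi> y \<in> spin_space y" if "y \<in> spacetime \<rho>" for y
    using L2 that by (auto simp: L2_loc_t_def wave_functions_on_def)
  have "k (\<lambda>x. \<psi> x + \<phi> x) x y + k (\<lambda>x. \<psi> x - \<phi> x) x y = 2 * (k \<psi> x y + k \<phi> x y)"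
    if "x \<in> spacetime \<rho>" "y \<in> spacetime \<rho>" for x y
  proof -
    have "Q x y (\<psi> y + \<phi> y) = Q x y (\<psi> y) + Q x y (\<phi> y)"
      using Q that wave by (simp add: symmetric_kernel_def)
    moreover have "Q x y (\<psi> y - \<phi> y) = Q x y (\<psi> y) - Q x y (\<phi> y)"
      using symmetric_kernel_diff[OF Q that] wave that by simp
    ultimately show ?thesis
      by (simp only: k_def spin_inner_def blinfun.add_right blinfun.diff_right cinner_simps)
        (simp add: algebra_simps)
  qed
  then have "(LINT x|spacetime_measure \<rho>. LINT y|spacetime_measure \<rho>. k (\<lambda>x. \<psi> x + \<phi> x) x y)
      + (LINT x|spacetime_measure \<rho>. LINT y|spacetime_measure \<rho>. k (\<lambda>x. \<psi> x - \<phi> x) x y)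
    = 2 * ((LINT x|spacetime_measure \<rho>. LINT y|spacetime_measure \<rho>. k \<psi> x y)
      + (LINT x|spacetime_measure \<rho>. LINT y|spacetime_measure \<rho>. k \<phi> x y))"
    using double_integral_parallelogram[OF ex ex ex ex] L2 by simp
  then show ?thesis
    unfolding layer_form_def k_def by (simp only: flip: distrib_left) (simp add: algebra_simps)
qed

text \<open>Where \<open>theta \<eta> t x\<close> is nonzero, the wave equation reduces the inner
  integral to a real multiple of \<open>spin_inner x (\<delta> x) (\<delta> x)\<close>, which is
  real. So the first part \<open>A\<close> of the derivative is real, while the second part is its
  conjugate; they cancel.\<close>

lemma layer_form_stationary:
  fixes \<rho> :: "'h::separable_complex_hilbert opr measure"
  assumes sa: "\<And>x. x \<in> spacetime \<rho> \<Longrightarrow> selfadjoint x"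
    and Q: "symmetric_kernel \<rho> Q" and conv: "layer_form_conventions \<rho> \<eta> Q"
    and deriv: "\<And>x. x \<in> spacetime \<rho> \<Longrightarrow> ((\<lambda>s. \<eta> s x) has_real_derivative theta \<eta> t x) (at t)"
    and \<delta>: "\<delta> \<in> L2_loc_t \<rho> \<eta>"
    and int: "AE x in spacetime_measure \<rho>. integrable (spacetime_measure \<rho>) (\<lambda>y. Q x y (\<delta> y))"
    and wave_eq: "AE x in spacetime_measure \<rho>. theta \<eta> t x \<noteq> 0 \<longrightarrow> Q_dyn \<rho> Q c \<delta> x = 0"
  shows "((\<lambda>s. layer_form \<rho> \<eta> Q s \<delta> \<delta>) has_vector_derivative 0) (at t)"
proof -
  define \<mu> where "\<mu> = spacetime_measure \<rho>"
  define k where "k x y = spin_inner x (\<delta> x) (Q x y (\<delta> y))" for x y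
  define A where "A = (LINT x|\<mu>. LINT y|\<mu>. of_real (theta \<eta> t x) * k x y)"
  have [simp]: "space \<mu> = spacetime \<rho>"
    by (simp add: \<mu>_def)
  have exx: "double_integral_exists \<mu> (\<lambda>x y. of_real (theta \<eta> t x) * k x y)"
    and exy: "double_integral_exists \<mu> (\<lambda>x y. of_real (theta \<eta> t y) * k x y)"
    and der: "((\<lambda>s. layer_form \<rho> \<eta> Q s \<delta> \<delta>) has_vector_derivative
          - 2 * \<i> * (LINT x|\<mu>. LINT y|\<mu>. of_real (deriv (\<lambda>s. layer_weight \<eta> s x y) t) * k x y)) (at t)"
    using conv \<delta> unfolding layer_form_conventions_def Let_def k_def \<mu>_def by blast+
  have wave: "\<delta> y \<in> spin_space y" if "y \<in> spacetime \<rho>" for y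
    using \<delta> that by (auto simp: L2_loc_t_def wave_functions_on_def)
  have cnj_spin: "cnj (spin_inner x u v) = spin_inner x v u" if "x \<in> spacetime \<rho>" for x u v
    using selfadjointD[OF sa[OF that]] by (simp add: spin_inner_def flip: cinner_commute)
  have k_cnj: "k x y = cnj (k y x)" if "x \<in> spacetime \<rho>" "y \<in> spacetime \<rho>" for x y
    using Q that wave cnj_spin by (simp add: k_def symmetric_kernel_def)
  have theta_k_cnj: "of_real (theta \<eta> t y) * k x y = cnj (of_real (theta \<eta> t y) * k y x)"
    if "x \<in> spacetime \<rho>" "y \<in> spacetime \<rho>" for x y
    using k_cnj[OF that] by simp
  have "Im A = (LINT x|\<mu>. Im (LINT y|\<mu>. of_real (theta \<eta> t x) * k x y))"
    unfolding A_def using exx[unfolded double_integral_exists_def, THEN conjunct2, THEN conjunct1]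
    by (rule integral_Im[symmetric])
  also have "\<dots> = 0"
  proof (rule integral_eq_zero_AE)
    show "AE x in \<mu>. Im (LINT y|\<mu>. of_real (theta \<eta> t x) * k x y) = 0"
      using int[folded \<mu>_def] wave_eq[folded \<mu>_def] AE_space
    proof eventually_elim
      case (elim x)
      have "(LINT y|\<mu>. of_real (theta \<eta> t x) * k x y) = of_real (theta \<eta> t x) * (LINT y|\<mu>. k x y)"
        by simp
      also have "(LINT y|\<mu>. k x y) = spin_inner x (\<delta> x) (LINT y|\<mu>. Q x y (\<delta> y))"
        unfolding k_def spin_inner_def
        using integral_bounded_linear[OF bounded_linear_compose[OF bounded_linear_cinner_right
              blinfun.bounded_linear_right] elim(1), of "\<delta> x" x]
        by simp
      also have "of_real (theta \<eta> t x) * \<dots> = of_real (- c * theta \<eta> t x) * spin_inner x (\<delta> x) (\<delta> x)"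
      proof (cases "theta \<eta> t x = 0")
        case False
        \<comment> \<open>\<open>Q_dyn\<close> includes the diagonal contribution \<open>c\<close>,
          so a vanishing \<open>Q_dyn\<close> leaves \<open>- c\<close> times the wave function for
          the pure integral.\<close>
        then have "(LINT y|\<mu>. Q x y (\<delta> y)) = - c *\<^sub>R \<delta> x"
          using elim(2) by (simp add: Q_dyn_def \<mu>_def eq_neg_iff_add_eq_0)
        then show ?thesis
          by (simp add: spin_inner_def blinfun.scaleR_right blinfun.minus_right cinner_simps)
      qed simp
      finally show ?case
        using cnj_spin[of x "\<delta> x" "\<delta> x"] elim(3) by (simp add: complex_eq_iff)
    qed
  qed
  finally have A_real: "cnj A = A"
    by (simp add: complex_eq_iff)
  \<comment> \<open>After interchange of the integrations, symmetry of the kernel turns this into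
    the conjugate of \<open>A\<close>.\<close>
  have "(LINT x|\<mu>. LINT y|\<mu>. of_real (theta \<eta> t y) * k x y)
      = (LINT y|\<mu>. LINT x|\<mu>. of_real (theta \<eta> t y) * k x y)"
    using exy by (simp add: double_integral_exists_def)
  also have "\<dots> = (LINT y|\<mu>. LINT x|\<mu>. cnj (of_real (theta \<eta> t y) * k y x))"
    by (intro Bochner_Integration.integral_cong refl theta_k_cnj) simp_all
  also have "\<dots> = cnj A"
    unfolding A_def by (simp only: Bochner_Integration.integral_cnj)
  finally have swap: "(LINT x|\<mu>. LINT y|\<mu>. of_real (theta \<eta> t y) * k x y) = A"
    using A_real by simp
  define f where "f x = (LINT y|\<mu>. of_real (deriv (\<lambda>s. layer_weight \<eta> s x y) t) * k x y)" for x
  have "(LINT x|\<mu>. f x) = 0"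
  \<comment> \<open>\<open>f\<close> equals an integrable function only almost everywhere. Without
    completeness of the measure this does not make \<open>f\<close> integrable, hence the case
    distinction.\<close>
  proof (cases "integrable \<mu> f")
    case True
    have "AE x in \<mu>. integrable \<mu> (\<lambda>y. of_real (theta \<eta> t x) * k x y)"
      "AE x in \<mu>. integrable \<mu> (\<lambda>y. of_real (theta \<eta> t y) * k x y)"
      using exx exy by (simp_all only: double_integral_exists_def)
    then have "AE x in \<mu>. f x =
        (LINT y|\<mu>. of_real (theta \<eta> t x) * k x y) - (LINT y|\<mu>. of_real (theta \<eta> t y) * k x y)"
      using AE_space
    proof eventually_elim
      case (elim x)
      have "deriv (\<lambda>s. layer_weight \<eta> s x y) t = theta \<eta> t x - theta \<eta> t y"
        if "y \<in> spacetime \<rho>" for y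
        unfolding layer_weight_eq using elim(3) that
        by (intro DERIV_imp_deriv DERIV_diff deriv) simp_all
      then have "f x = (LINT y|\<mu>. of_real (theta \<eta> t x) * k x y - of_real (theta \<eta> t y) * k x y)"
        unfolding f_def by (intro Bochner_Integration.integral_cong refl) (simp add: left_diff_distrib)
      then show ?case
        using elim(1,2) by (simp only: Bochner_Integration.integral_diff)
    qed
    then have "(LINT x|\<mu>. f x) = (LINT x|\<mu>.
        (LINT y|\<mu>. of_real (theta \<eta> t x) * k x y) - (LINT y|\<mu>. of_real (theta \<eta> t y) * k x y))"
      using True exx exy unfolding double_integral_exists_def
      by (intro integral_cong_AE borel_measurable_diff borel_measurable_integrable) blast+
    also have "\<dots> = A - A"
      using exx exy swap unfolding double_integral_exists_def A_def
      by (subst Bochner_Integration.integral_diff) auto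
    finally show ?thesis by simp
  qed (simp add: not_integrable_integral_eq) \<comment> \<open>junk value \<open>0\<close>, which is the desired one\<close>
  then show ?thesis
    using der by (simp add: f_def)
qed

theorem corollary6p10:
  fixes F :: "'h::separable_complex_hilbert opr set" and \<rho> :: "'h opr measure"
    and n :: nat and \<kappa> :: real and Hf :: "'h set" and \<Omega>0 :: "'h opr set"
    and Cvary :: "'h wave set" and Q :: "'h kernel" and c :: real
    and \<eta> :: "real \<Rightarrow> 'h opr \<Rightarrow> real"
    and t0 tmax :: real and w \<psi> \<psi>' :: "'h wave"
  assumes "causal_fermion_system n F \<rho>"
    and "four_causal_classes n \<kappa> Hf \<rho> \<Omega>0"
    and "Cvary \<subseteq> continuous_wave_functions \<rho>" and "wave_subspace Cvary"
    and "symmetric_kernel \<rho> Q"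
    and "global_foliation (past_sets n \<kappa> Hf \<rho> \<Omega>0) \<rho> \<eta>"
    and "layer_form_conventions \<rho> \<eta> Q"
    and "finite_time_range \<rho> \<eta> Q c"
    and "hyperbolicity_condition \<rho> \<eta> Q Cvary"
    and "t0 < tmax"
    and "w \<in> L2_strip \<rho> \<eta> t0 tmax"
    and "\<psi> \<in> Cvary \<inter> L2_loc_t \<rho> \<eta>" and "\<psi>' \<in> Cvary \<inter> L2_loc_t \<rho> \<eta>"
    and "L2_strip_eq \<rho> \<eta> t0 tmax (Q_dyn \<rho> Q c \<psi>) w"
    and "L2_strip_eq \<rho> \<eta> t0 tmax (Q_dyn \<rho> Q c \<psi>') w"
    and "layer_norm \<rho> \<eta> Q t0 \<psi> = 0" and "layer_norm \<rho> \<eta> Q t0 \<psi>' = 0"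
  shows "L2_strip_eq \<rho> \<eta> t0 tmax \<psi> \<psi>'"
proof -
  note sub = assms(3) and Cvary = assms(4) and Q = assms(5) and conv = assms(7)
    and range = assms(8) and t = assms(10) and \<psi> = assms(12) and \<psi>' = assms(13)
  define M where "M = spacetime \<rho>"
  define \<mu> where "\<mu> = spacetime_measure \<rho>"
  define \<delta> where "\<delta> x = \<psi> x - \<psi>' x" for x
  define N where "N \<xi> = (\<lambda>x. Re (spin_scalar x (\<xi> x) (\<xi> x)))" for \<xi> :: "'h wave"
  define E where "E s \<xi> = Re (layer_form \<rho> \<eta> Q s \<xi> \<xi>)" for s \<xi>
  have space_\<mu> [simp]: "space \<mu> = M"
    by (simp add: \<mu>_def M_def)
  have sets: "sets \<rho> = sets (restrict_space borel F)"
    using assms(1) by (simp add: causal_fermion_system_def regular_borel_measure_on_def)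
  have "space \<rho> = F"
    using sets_eq_imp_space_eq[OF sets] by (simp add: space_restrict_space)
  then have sa: "selfadjoint x" if "x \<in> spacetime \<rho>" for x
    using assms(1) that by (auto simp: causal_fermion_system_def spacetime_def)

  \<comment> \<open>Monotonicity of the time functions; null sets of strip and leaves\<close>
  have sm: "smooth_on (UNIV \<times> spacetime \<rho>) (\<lambda>(t, x). \<eta> t x)"
    and \<theta>: "\<And>s x. x \<in> spacetime \<rho> \<Longrightarrow> 0 \<le> theta \<eta> s x"
    using assms(6) by (simp_all add: global_foliation_def Let_def)
  note deriv = has_real_derivative_theta[OF sm]
    and \<theta>_cont = continuous_on_section[OF continuous_on_theta[OF sm]]
    and \<eta>_cont = continuous_on_section(1)[OF smooth_on_continuous_on[OF sm]]
  have mono: "\<eta> s x \<le> \<eta> s' x" if "x \<in> spacetime \<rho>" "s \<le> s'" for s s' x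
    using that(2) by (rule DERIV_nonneg_imp_nondecreasing) (use deriv[OF that(1)] \<theta>[OF that(1)] in blast)
  \<comment> \<open>The wave equation is known only almost everywhere for the strip measure. A
    positive time derivative at an inner time makes \<open>\<eta>\<close> increase strictly just
    afterwards, still before \<open>tmax\<close>, so the leaf at that time lies where the strip
    weight is positive.\<close>
  have strip_pos: "\<eta> t0 x < \<eta> tmax x" if x: "x \<in> M" and s: "t0 < s" "s < tmax" "theta \<eta> s x \<noteq> 0" for s x
  proof -
    have "0 < theta \<eta> s x"
      using \<theta>[of x s] x s(3) by (simp add: M_def)
    with deriv[of x s] obtain d where d: "0 < d" "\<And>h. 0 < h \<Longrightarrow> h < d \<Longrightarrow> \<eta> s x < \<eta> (s + h) x"
      using DERIV_pos_inc_right x unfolding M_def by blast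
    define h where "h = min (d / 2) (tmax - s)"
    have h: "0 < h" "h < d" "s + h \<le> tmax"
      using d(1) s by (auto simp: h_def)
    have "\<eta> t0 x \<le> \<eta> s x" "\<eta> (s + h) x \<le> \<eta> tmax x"
      using mono x s h by (simp_all add: M_def)
    with d(2)[OF h(1,2)] show ?thesis by simp
  qed
  have meas: "f \<in> borel_measurable \<mu>" if "continuous_on M f" for f :: "'h opr \<Rightarrow> real"
    using spacetime_measurable[OF sets] that by (simp add: M_def \<mu>_def)
  have AE_strip: "(AE x in strip_measure \<rho> \<eta> t0 tmax. P x) \<longleftrightarrow> (AE x in \<mu>. \<eta> t0 x < \<eta> tmax x \<longrightarrow> P x)" for P
    unfolding strip_measure_def \<mu>_def[symmetric]
    by (subst AE_density) (use meas \<eta>_cont in \<open>auto simp: M_def\<close>)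
  have AE_leaf: "(AE x in leaf_measure \<rho> \<eta> s. P x) \<longleftrightarrow> (AE x in \<mu>. 0 < theta \<eta> s x \<longrightarrow> P x)" for P s
    unfolding leaf_measure_def \<mu>_def[symmetric]
    by (subst AE_density) (use meas \<theta>_cont(1) in \<open>auto simp: M_def\<close>)

  \<comment> \<open>Sum and difference of the two solutions\<close>
  have Cvary_sum: "(\<lambda>x. \<psi> x + \<psi>' x) \<in> Cvary" and Cvary_diff: "\<delta> \<in> Cvary"
  proof -
    show "(\<lambda>x. \<psi> x + \<psi>' x) \<in> Cvary"
      using Cvary \<psi> \<psi>' by (simp add: wave_subspace_def)
    \<comment> \<open>\<open>wave_subspace\<close> speaks of sums and scalar multiples, so the
      difference is assembled from these.\<close>
    have "(\<lambda>x. (-1) *\<^sub>C \<psi>' x) \<in> Cvary"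
      using Cvary \<psi>' by (simp only: wave_subspace_def Int_iff)
    then have "(\<lambda>x. \<psi> x + (-1) *\<^sub>C \<psi>' x) \<in> Cvary"
      using Cvary \<psi> by (simp only: wave_subspace_def Int_iff)
    then show "\<delta> \<in> Cvary"
      by (simp add: \<delta>_def[abs_def])
  qed
  have L2_sum: "(\<lambda>x. \<psi> x + \<psi>' x) \<in> L2_loc_t \<rho> \<eta>" and L2_diff: "\<delta> \<in> L2_loc_t \<rho> \<eta>"
    using \<psi> \<psi>' Cvary_sum Cvary_diff sub unfolding \<delta>_def[abs_def]
    by (auto intro!: L2_loc_t_add[where \<eta> = \<eta>, OF sets sa \<eta>_cont mono]
        L2_loc_t_diff[where \<eta> = \<eta>, OF sets sa \<eta>_cont mono])

  \<comment> \<open>Hyperbolicity and zero initial data for the difference\<close>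
  have "\<exists>C>0. \<forall>s\<in>{t0..tmax}. \<forall>\<xi>\<in>Cvary \<inter> L2_loc_t \<rho> \<eta>.
      integrable (leaf_measure \<rho> \<eta> s) (N \<xi>) \<and>
      1 / C\<^sup>2 * (LINT x|leaf_measure \<rho> \<eta> s. N \<xi> x) \<le> E s \<xi>"
    using assms(9) unfolding hyperbolicity_condition_def N_def E_def
    by (elim allE[of _ t0] allE[of _ tmax]) simp
  then obtain C where C: "0 < C" and hyp: "\<And>s \<xi>. s \<in> {t0..tmax} \<Longrightarrow> \<xi> \<in> Cvary \<Longrightarrow> \<xi> \<in> L2_loc_t \<rho> \<eta> \<Longrightarrow>
      integrable (leaf_measure \<rho> \<eta> s) (N \<xi>) \<and> 1 / C\<^sup>2 * (LINT x|leaf_measure \<rho> \<eta> s. N \<xi> x) \<le> E s \<xi>"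
    by blast
  have N_nonneg: "0 \<le> N \<xi> x" if "x \<in> M" for \<xi> x
    using sa that by (simp add: N_def M_def Re_spin_scalar_self)
  have leaf_nonneg: "AE x in leaf_measure \<rho> \<eta> s. 0 \<le> N \<xi> x" for s \<xi>
    unfolding AE_leaf using N_nonneg by (auto intro: AE_I2)
  have E_nonneg: "0 \<le> E s \<xi>" if "s \<in> {t0..tmax}" "\<xi> \<in> Cvary" "\<xi> \<in> L2_loc_t \<rho> \<eta>" for s \<xi>
    using integral_nonneg_AE[OF leaf_nonneg, of s \<xi>] hyp[OF that]
    by (smt (verit) divide_nonneg_nonneg mult_nonneg_nonneg zero_le_power2)
  have "E t0 (\<lambda>x. \<psi> x + \<psi>' x) + E t0 \<delta> = 2 * (E t0 \<psi> + E t0 \<psi>')"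
    using arg_cong[OF layer_form_parallelogram[OF Q conv _ _ L2_sum L2_diff[unfolded \<delta>_def[abs_def]]], of Re] \<psi> \<psi>'
    by (simp add: E_def \<delta>_def[abs_def])
  \<comment> \<open>The real \<open>sqrt\<close> extends to negative numbers as an odd function, so
    it vanishes only at 0 and no sign of the form has to be known here.\<close>
  moreover have "E t0 \<psi> = 0" "E t0 \<psi>' = 0"
    using assms(16,17) by (simp_all add: layer_norm_def E_def)
  ultimately have E0: "E t0 \<delta> = 0"
    using E_nonneg[OF _ Cvary_sum L2_sum, of t0] E_nonneg[OF _ Cvary_diff L2_diff, of t0] t by auto

  \<comment> \<open>Homogeneous wave equation for the difference\<close>
  have int_Q: "AE x in \<mu>. integrable \<mu> (\<lambda>y. Q x y (\<xi> y))" if "\<xi> \<in> L2_loc_t \<rho> \<eta>" for \<xi>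
    using range that unfolding finite_time_range_def \<mu>_def by blast
  have wave: "\<psi> y \<in> spin_space y" "\<psi>' y \<in> spin_space y" if "y \<in> M" for y
    using \<psi> \<psi>' that by (auto simp: L2_loc_t_def wave_functions_on_def M_def)
  have "AE x in \<mu>. integrable \<mu> (\<lambda>y. Q x y (\<psi> y))" "AE x in \<mu>. integrable \<mu> (\<lambda>y. Q x y (\<psi>' y))"
    "AE x in \<mu>. \<eta> t0 x < \<eta> tmax x \<longrightarrow> Q_dyn \<rho> Q c \<psi> x = w x"
    "AE x in \<mu>. \<eta> t0 x < \<eta> tmax x \<longrightarrow> Q_dyn \<rho> Q c \<psi>' x = w x"
    using int_Q \<psi> \<psi>' assms(14,15) by (simp_all add: L2_strip_eq_def AE_strip)
  then have eq: "AE x in \<mu>. \<eta> t0 x < \<eta> tmax x \<longrightarrow> Q_dyn \<rho> Q c \<delta> x = 0"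
    using AE_space
  proof eventually_elim
    case (elim x)
    have "(LINT y|\<mu>. Q x y (\<delta> y)) = (LINT y|\<mu>. Q x y (\<psi> y) - Q x y (\<psi>' y))"
      using elim(5) wave symmetric_kernel_diff[OF Q, of x]
      by (intro Bochner_Integration.integral_cong refl) (simp add: \<delta>_def M_def)
    also have "\<dots> = (LINT y|\<mu>. Q x y (\<psi> y)) - (LINT y|\<mu>. Q x y (\<psi>' y))"
      using elim(1,2) by (rule Bochner_Integration.integral_diff)
    finally have "Q_dyn \<rho> Q c \<delta> x = Q_dyn \<rho> Q c \<psi> x - Q_dyn \<rho> Q c \<psi>' x"
      by (simp add: Q_dyn_def \<mu>_def \<delta>_def scaleR_diff_right)
    then show ?case
      using elim(3,4) by simp
  qed

  \<comment> \<open>Conservation of the form in the strip\<close>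
  have stat: "((\<lambda>s. layer_form \<rho> \<eta> Q s \<delta> \<delta>) has_vector_derivative 0) (at s)" if "t0 < s" "s < tmax" for s
  proof (rule layer_form_stationary[OF sa Q conv deriv L2_diff])
    show "AE x in spacetime_measure \<rho>. integrable (spacetime_measure \<rho>) (\<lambda>y. Q x y (\<delta> y))"
      using int_Q[OF L2_diff] unfolding \<mu>_def .
    show "AE x in spacetime_measure \<rho>. theta \<eta> s x \<noteq> 0 \<longrightarrow> Q_dyn \<rho> Q c \<delta> x = 0"
      using eq AE_space unfolding \<mu>_def[symmetric]
      by eventually_elim (use strip_pos that in auto)
  qed
  \<comment> \<open>The derivative is shown to vanish only at inner times. Differentiability at
    every real time, part of the conventions, gives the continuity that carries conservation to both
    endpoints.\<close>
  have "isCont (\<lambda>s. layer_form \<rho> \<eta> Q s \<delta> \<delta>) s" for s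
    using conv L2_diff unfolding layer_form_conventions_def Let_def
    by (blast intro: has_vector_derivative_continuous)
  then have E_cont: "continuous_on {t0..tmax} (\<lambda>s. E s \<delta>)"
    unfolding E_def by (intro continuous_on_Re continuous_at_imp_continuous_on) blast
  have E_deriv: "((\<lambda>s. E s \<delta>) has_real_derivative 0) (at s)" if "t0 < s" "s < tmax" for s
    using bounded_linear.has_vector_derivative[OF bounded_linear_Re stat[OF that]]
    by (simp add: E_def has_real_derivative_iff_has_vector_derivative)
  have E_zero: "E s \<delta> = 0" if "t0 \<le> s" "s \<le> tmax" for s
    using DERIV_isconst2[OF t E_cont E_deriv that] E0 by simp

  \<comment> \<open>Vanishing of the difference, first on each leaf and then in the strip\<close>
  have leaf_zero: "AE x in \<mu>. 0 < theta \<eta> s x \<longrightarrow> \<delta> x = 0" if s: "s \<in> {t0..tmax}" for s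
  proof -
    have int: "integrable (leaf_measure \<rho> \<eta> s) (N \<delta>)"
      and "1 / C\<^sup>2 * (LINT x|leaf_measure \<rho> \<eta> s. N \<delta> x) \<le> 0"
      using hyp[OF s Cvary_diff L2_diff] E_zero s by auto
    then have "(LINT x|leaf_measure \<rho> \<eta> s. N \<delta> x) = 0"
      using C integral_nonneg_AE[OF leaf_nonneg, of s \<delta>]
      by (simp add: mult_le_0_iff divide_le_0_iff)
    then have "AE x in leaf_measure \<rho> \<eta> s. N \<delta> x = 0"
      using integral_nonneg_eq_0_iff_AE[OF int leaf_nonneg] by simp
    then have "AE x in \<mu>. 0 < theta \<eta> s x \<longrightarrow> N \<delta> x = 0"
      by (simp add: AE_leaf)
    then show ?thesis
      using AE_space
    proof eventually_elim
      case (elim x)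
      have "\<delta> x \<in> spin_space x"
        using L2_diff elim(2) by (auto simp: L2_loc_t_def wave_functions_on_def M_def)
      then show ?case
        using elim spin_scalar_eq_0[OF sa] by (auto simp: N_def M_def)
    qed
  qed
  \<comment> \<open>The exceptional null set depends on the time; only countably many of them may be
    united, hence the restriction to rational times.\<close>
  have "AE x in \<mu>. \<forall>s\<in>\<rat> \<inter> {t0..tmax}. 0 < theta \<eta> s x \<longrightarrow> \<delta> x = 0"
    by (subst AE_ball_countable) (use leaf_zero countable_rat in auto)
  then have "AE x in \<mu>. \<eta> t0 x < \<eta> tmax x \<longrightarrow> \<psi> x = \<psi>' x"
    using AE_space
  proof eventually_elim
    case (elim x)
    show ?case
    proof
      assume less: "\<eta> t0 x < \<eta> tmax x"
      have x: "x \<in> spacetime \<rho>" using elim(2) by (simp add: M_def)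
      \<comment> \<open>Growth of \<open>\<eta>\<close> across the strip forces a positive time
        derivative at some inner time \<open>z\<close>. Positivity is an open condition in time, so
        it also holds at a rational time.\<close>
      obtain z where z: "t0 < z" "z < tmax" "\<eta> tmax x - \<eta> t0 x = (tmax - t0) * theta \<eta> z x"
        using MVT2[OF t, of "\<lambda>s. \<eta> s x" "\<lambda>s. theta \<eta> s x", OF deriv[OF x]] by blast
      have "0 < theta \<eta> z x"
        using less z(3) t by (metis diff_gt_0_iff_gt zero_less_mult_pos)
      moreover have "open ({t0<..<tmax} \<inter> (\<lambda>s. theta \<eta> s x) -` {0<..})"
        by (intro open_Int open_vimage \<theta>_cont(2) x) auto
      ultimately have "({t0<..<tmax} \<inter> (\<lambda>s. theta \<eta> s x) -` {0<..}) \<inter> \<rat> \<noteq> {}"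
        using z(1,2) by (subst open_Int_closure_eq_empty[symmetric]) (auto simp: Rats_closure_real)
      then obtain q where "q \<in> \<rat>" "q \<in> {t0<..<tmax} \<inter> (\<lambda>s. theta \<eta> s x) -` {0<..}"
        by blast
      then have "\<delta> x = 0"
        using elim(1) by auto
      then show "\<psi> x = \<psi>' x"
        by (simp add: \<delta>_def)
    qed
  qed
  then show ?thesis
    by (simp add: L2_strip_eq_def AE_strip)
qed

end
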